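(* Fix $\beta>0$ and a standard Brownian motion $B$. There exists an event of probability one on which the following holds. For all $a\in\mathbb{R}$ and all $(t_0,x_0)\in\mathbb{R}_+\times(\mathbb{R}\cup\{+\infty\})$, the forward diffusion $Z_a^{(t_0,x_0)}(t)$ converges to either $+\infty$ or $-\infty$ as $t\to\infty$. Moreover, for all $a\in\mathbb{R}$ there exists a unique path $\hat Z_a=\hat Z_a^{(+\infty,-\infty)}$ solving $$d\hat Z_a(t) = \Big(a+\frac\beta4 t-\hat Z_a(t)^2\Big)dt + dB(t),\quad t\in[0,\infty),\qquad \hat Z_a(+\infty)=-\infty.$$
   Context: For $a\in\mathbb{R}$ and $(t_0,x_0)\in\mathbb{R}_+\times(-\infty,+\infty]$, the forward diffusion $Z_a^{(t_0,x_0)}$ is the solution on $[t_0,\infty)$ of $dZ(t)=(a+\frac\beta4 t-Z(t)^2)dt+dB(t)$, $Z(t_0)=x_0$ (it comes down from $+\infty$ if $x_0=+\infty$); whenever it hits $-\infty$ in finite time it is restarted immediately from $+\infty$. A path is a function from an interval of $\mathbb{R}$ into $\mathbb{R}\cup\{\pm\infty\}$; a path solving the equation above backward in time, when it hits $+\infty$ (as time decreases), is restarted from $-\infty$. All these objects are solutions of ODEs driven pathwise by the continuous trajectory of $B$. *)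

theory Defs
  imports "HOL-Probability.Probability"
begin

definition std_brownian_motion :: "'a measure \<Rightarrow> (real \<Rightarrow> 'a \<Rightarrow> real) \<Rightarrow> bool" where
  "std_brownian_motion M B \<longleftrightarrow>
     prob_space M \<and>
     (\<forall>t\<ge>0. B t \<in> borel_measurable M) \<and>
     (\<forall>\<omega>\<in>space M. B 0 \<omega> = 0 \<and> continuous_on {0..} (\<lambda>t. B t \<omega>)) \<and>
     (\<forall>s t. 0 \<le> s \<longrightarrow> s < t \<longrightarrow>
        distributed M lborel (\<lambda>\<omega>. B t \<omega> - B s \<omega>)
          (\<lambda>x. ennreal (normal_density 0 (sqrt (t - s)) x))) \<and>
     (\<forall>ts::real list. sorted_wrt (<) ts \<longrightarrow> (\<forall>t\<in>set ts. 0 \<le> t) \<longrightarrow>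
        prob_space.indep_vars M (\<lambda>_. borel)
          (\<lambda>i \<omega>. B (ts ! Suc i) \<omega> - B (ts ! i) \<omega>) {..<length ts - 1})"

text \<open>Pathwise solution, on the time set I, of
  dZ = (a + \<beta>/4 t - Z^2) dt + db(t), with explosions/restarts.
  Z takes values in ereal. At every time t \<in> I either
  (i) Z t is finite, Z is finite on a neighbourhood of t in I and
      Z - b is differentiable at t (within I) with derivative a + \<beta>/4 t - Z(t)^2; or
  (ii) t is an explosion/restart time: Z t = jv (the value from which the path is
      restarted: +\<infinity> for forward paths, -\<infinity> for backward paths), Z is finite on a
      punctured neighbourhood of t in I, Z(s) \<rightarrow> +\<infinity> as s \<rightarrow> t+ and
      Z(s) \<rightarrow> -\<infinity> as s \<rightarrow> t- (within I; vacuous at the left endpoint of I).\<close>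
definition riccati_path ::
  "real \<Rightarrow> real \<Rightarrow> (real \<Rightarrow> real) \<Rightarrow> real set \<Rightarrow> ereal \<Rightarrow> (real \<Rightarrow> ereal) \<Rightarrow> bool" where
  "riccati_path \<beta> a b I jv Z \<longleftrightarrow>
     (\<forall>t\<in>I.
        (Z t \<noteq> \<infinity> \<and> Z t \<noteq> -\<infinity> \<and>
         (\<exists>\<delta>>0. \<forall>s\<in>I. \<bar>s - t\<bar> < \<delta> \<longrightarrow> Z s \<noteq> \<infinity> \<and> Z s \<noteq> -\<infinity>) \<and>
         ((\<lambda>s. real_of_ereal (Z s) - b s) has_real_derivative
             (a + \<beta> / 4 * t - (real_of_ereal (Z t))\<^sup>2)) (at t within I))
      \<or>
        (Z t = jv \<and>
         (\<exists>\<delta>>0. \<forall>s\<in>I. 0 < \<bar>s - t\<bar> \<and> \<bar>s - t\<bar> < \<delta> \<longrightarrow> Z s \<noteq> \<infinity> \<and> Z s \<noteq> -\<infinity>) \<and>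
         (Z \<longlongrightarrow> \<infinity>) (at t within (I \<inter> {t<..})) \<and>
         (Z \<longlongrightarrow> -\<infinity>) (at t within (I \<inter> {..<t}))))"

definition forward_diffusion ::
  "real \<Rightarrow> real \<Rightarrow> (real \<Rightarrow> real) \<Rightarrow> real \<Rightarrow> ereal \<Rightarrow> (real \<Rightarrow> ereal) \<Rightarrow> bool" where
  "forward_diffusion \<beta> a b t0 x0 Z \<longleftrightarrow> Z t0 = x0 \<and> riccati_path \<beta> a b {t0..} \<infinity> Z"

text \<open>A path on [0,\<infinity>) solving the equation backward in time: when it hits +\<infinity> (as time
  decreases) it is restarted from -\<infinity>.\<close>
definition backward_path ::
  "real \<Rightarrow> real \<Rightarrow> (real \<Rightarrow> real) \<Rightarrow> (real \<Rightarrow> ereal) \<Rightarrow> bool" where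
  "backward_path \<beta> a b Z \<longleftrightarrow> riccati_path \<beta> a b {0..} (-\<infinity>) Z"

end

theory Submission
  imports Defs
begin

text \<open>Writing \<open>Z = b + \<psi> / \<phi>\<close> linearises the Riccati equation: paths, through all their restarts,
  correspond to nontrivial solutions of a linear system, the restart times being the zeros of \<open>\<phi>\<close>.
  Almost surely the oscillation of \<open>B\<close> on \<open>[t, t + 1]\<close> is \<open>o(\<surd>t)\<close>, so \<open>B\<close> may be replaced by its
  difference \<open>d\<close> to a moving average, at the cost of a perturbation of the drift that is
  negligible against \<open>\<beta>t/4\<close>. Then \<open>(\<phi>\<psi>)' = \<psi>\<^sup>2 + (q - d\<^sup>2) \<phi>\<^sup>2 > 0\<close> for large times. If \<open>\<phi>\<psi>\<close>
  becomes positive it stays so, \<open>\<phi>\<close> has no further zero, and \<open>Z\<close> is driven to \<open>+\<infinity>\<close>; otherwise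
  \<open>\<phi>\<psi> < 0\<close> for all large times and \<open>Z\<close> tends to \<open>-\<infinity>\<close>. The latter solutions exist by compactness of
  the set of directions, and they are unique up to a factor because two of them with nonzero
  Wronskian would make the sum of their products grow linearly.\<close>

section \<open>Linear systems and Riccati paths\<close>

text \<open>Taking d = B in the linear system would not do: by the law of the iterated logarithm
  B(t)^2 exceeds every multiple of t at arbitrarily large times, so the potential q - d^2 would
  become negative again and again, whatever the size of \<beta>. Only the oscillation of B over unit
  windows is small enough to be beaten by the drift. The linear form also disposes of the restarts.
  A restart is the passage of [\<phi> : \<psi>] through one point of the projective line, where the
  linear system is as regular as anywhere else. The value assigned there is a mere convention, so
  forward and backward paths come from the same linear solutions. The probabilistic input,
  \<open>subsqrt_osc\<close>, mentions neither a nor (t0, x0). All else is deterministic, and hence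
  one null set serves all parameters at once.\<close>

lemma integral_has_vector_derivative_Ici:
  fixes g :: "real \<Rightarrow> 'a::banach"
  assumes "continuous_on {0..} g" "t \<ge> 0"
  shows "((\<lambda>u. integral {0..u} g) has_vector_derivative g t) (at t within {0..})"
proof -
  have "continuous_on {0..t+1} g"
    using assms(1) by (rule continuous_on_subset) auto
  from integral_has_vector_derivative[OF this, of t] assms(2)
  have "((\<lambda>u. integral {0..u} g) has_vector_derivative g t) (at t within {0..t+1})" by simp
  also have "at t within {0..t+1} = at t within {0..}"
    by (rule at_within_nhd[where S = "{..<t+1}"]) (use assms(2) in auto)
  finally show ?thesis .
qed

text \<open>The Lipschitz constant may grow with T, so the integral operator need not contract on
  the whole half-line. The iterates are nevertheless defined globally and converge uniformly on each
  [0, T], so no solution has to be continued from one interval to the next.\<close>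

lemma picard_lindelof_half_line:
  fixes f :: "real \<Rightarrow> 'a::banach \<Rightarrow> 'a"
  assumes cont: "\<And>x. continuous_on {0..} x \<Longrightarrow> continuous_on {0..} (\<lambda>t. f t (x t))"
    and Lip: "\<And>T. \<exists>L. \<forall>t\<in>{0..T}. \<forall>x y. norm (f t x - f t y) \<le> L * norm (x - y)"
  shows "\<exists>x. x 0 = x0 \<and> (\<forall>t\<ge>0. (x has_vector_derivative f t (x t)) (at t within {0..}))"
proof -
  have loc: "at t within {0..t+1} = at t within {0..}" if "t \<ge> 0" for t :: real
    by (rule at_within_nhd[where S = "{..<t+1}"]) (use that in auto)
  have int_on: "g integrable_on {0..t}" if "continuous_on {0..} g" for g :: "real \<Rightarrow> 'a" and t
    by (rule integrable_continuous_real, rule continuous_on_subset[OF that]) auto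
  define X where "X = rec_nat (\<lambda>t. x0) (\<lambda>n x t. x0 + integral {0..t} (\<lambda>s. f s (x s)))"
  have X0: "X 0 t = x0" and XS: "X (Suc n) t = x0 + integral {0..t} (\<lambda>s. f s (X n s))" for n t
    by (simp_all add: X_def)
  have contX: "continuous_on {0..} (X n)" for n
  proof (induction n)
    case 0 then show ?case by (simp add: X0 cong: continuous_on_cong)
  next
    case (Suc n)
    have "((\<lambda>u. x0 + integral {0..u} (\<lambda>s. f s (X n s))) has_vector_derivative 0 + f t (X n t)) (at t within {0..})"
      if "t \<ge> 0" for t
      by (intro derivative_intros has_vector_derivative_add integral_has_vector_derivative_Ici cont Suc that)
    then have "continuous_on {0..} (\<lambda>u. x0 + integral {0..u} (\<lambda>s. f s (X n s)))"
      by (intro continuous_on_vector_derivative) auto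
    then show ?case by (simp add: XS cong: continuous_on_cong)
  qed
  define x where "x t = x0 + (\<Sum>i. X (Suc i) t - X i t)" for t
  have unif: "uniform_limit {0..T} X x sequentially" for T
  proof -
    obtain L0 where L0: "norm (f t x - f t y) \<le> L0 * norm (x - y)" if "t \<in> {0..T}" for t x y
      using Lip[of T] by blast
    define L where "L = max L0 1"
    have L: "L > 0" "norm (f t x - f t y) \<le> L * norm (x - y)" if "t \<in> {0..T}" for t x y
    proof -
      show "L > 0" by (simp add: L_def)
      have "L0 * norm (x - y) \<le> L * norm (x - y)"
        by (intro mult_right_mono) (auto simp: L_def)
      with L0[OF that, of x y] show "norm (f t x - f t y) \<le> L * norm (x - y)" by linarith
    qed
    have Lpos: "L > 0" by (simp add: L_def)
    have "compact ((\<lambda>t. X 1 t - X 0 t) ` {0..T})"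
      by (intro compact_continuous_image continuous_intros continuous_on_subset[OF contX]) auto
    then obtain C where C: "norm (X 1 t - X 0 t) \<le> C" if "t \<in> {0..T}" for t
      by (meson bounded_iff compact_imp_bounded imageI)
    \<comment> \<open>The weight exp (2 L t) replaces a smallness condition on T: integrating L
      times the weight returns at most half of it, so every iteration gains a factor 1/2.\<close>
    have bd: "norm (X (Suc n) t - X n t) \<le> C * exp (2 * L * t) / 2 ^ n" if "t \<in> {0..T}" for n t
      using that
    proof (induction n arbitrary: t)
      case 0
      have "norm (X 1 t - X 0 t) \<le> C" using C 0 by blast
      also have "\<dots> \<le> C * exp (2 * L * t)"
        using 0 Lpos order_trans[OF norm_ge_zero C[OF 0]] by (simp add: mult_le_cancel_left1)
      finally show ?case by simp
    next
      case (Suc n)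
      have FTC: "((\<lambda>s. L * (C * exp (2 * L * s) / 2 ^ n)) has_integral
              (C * exp (2 * L * t) / 2 ^ Suc n - C * exp (2 * L * 0) / 2 ^ Suc n)) {0..t}"
        using Suc.prems Lpos
        by (intro fundamental_theorem_of_calculus)
           (auto intro!: derivative_eq_intros simp flip: has_real_derivative_iff_has_vector_derivative)
      have "X (Suc (Suc n)) t - X (Suc n) t
              = integral {0..t} (\<lambda>s. f s (X (Suc n) s) - f s (X n s))"
        by (simp add: XS[of "Suc n"] XS[of n t] integral_diff int_on cont contX)
      also have "norm \<dots> \<le> integral {0..t} (\<lambda>s. L * (C * exp (2 * L * s) / 2 ^ n))"
      proof (rule integral_norm_bound_integral)
        show "(\<lambda>s. f s (X (Suc n) s) - f s (X n s)) integrable_on {0..t}"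
          by (intro int_on continuous_intros cont contX)
        show "(\<lambda>s. L * (C * exp (2 * L * s) / 2 ^ n)) integrable_on {0..t}"
          using FTC by blast
        fix s assume "s \<in> {0..t}"
        then have s: "s \<in> {0..T}" using Suc.prems by auto
        have "norm (f s (X (Suc n) s) - f s (X n s)) \<le> L * norm (X (Suc n) s - X n s)"
          using L(2)[OF s] .
        also have "\<dots> \<le> L * (C * exp (2 * L * s) / 2 ^ n)"
          using Suc.IH[OF s] Lpos by (intro mult_left_mono) auto
        finally show "norm (f s (X (Suc n) s) - f s (X n s)) \<le> L * (C * exp (2 * L * s) / 2 ^ n)" .
      qed
      also have "\<dots> \<le> C * exp (2 * L * t) / 2 ^ Suc n"
        unfolding integral_unique[OF FTC] using order_trans[OF norm_ge_zero C[OF Suc.prems]] by simp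
      finally show ?case .
    qed
    have "uniform_limit {0..T} (\<lambda>n t. \<Sum>i<n. X (Suc i) t - X i t) (\<lambda>t. \<Sum>i. X (Suc i) t - X i t) sequentially"
    proof (rule Weierstrass_m_test)
      fix n t assume t: "t \<in> {0..T}"
      have "C * exp (2 * L * t) \<le> C * exp (2 * L * T)"
        using t Lpos order_trans[OF norm_ge_zero C[OF t]] by (intro mult_left_mono) auto
      then have "C * exp (2 * L * t) / 2 ^ n \<le> C * exp (2 * L * T) * (1/2) ^ n"
        by (simp add: power_one_over divide_right_mono flip: divide_inverse)
      with bd[OF t, of n] show "norm (X (Suc n) t - X n t) \<le> C * exp (2 * L * T) * (1/2) ^ n"
        by linarith
    qed (intro summable_mult summable_geometric, simp)
    then have "uniform_limit {0..T} (\<lambda>n t. x0 + (\<Sum>i<n. X (Suc i) t - X i t)) x sequentially"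
      unfolding x_def by (intro uniform_limit_intros)
    moreover have "x0 + (\<Sum>i<n. X (Suc i) t - X i t) = X n t" for n t
      using sum_lessThan_telescope[of "\<lambda>i. X i t" n] by (simp add: X0)
    ultimately show ?thesis by simp
  qed
  have contx: "continuous_on {0..} x"
  proof -
    have "continuous (at t within {0..}) x" if "t \<ge> 0" for t
    proof -
      have "continuous_on {0..t+1} x"
        by (rule uniform_limit_theorem[OF _ unif]) (auto intro!: always_eventually continuous_on_subset[OF contX])
      then have "continuous (at t within {0..t+1}) x"
        using that by (simp add: continuous_on_eq_continuous_within)
      then show ?thesis by (simp add: loc that)
    qed
    then show ?thesis by (simp add: continuous_on_eq_continuous_within)
  qed
  have x_eq: "x t = x0 + integral {0..t} (\<lambda>s. f s (x s))" if "t \<ge> 0" for t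
  proof -
    obtain L0 where L0: "norm (f s x - f s y) \<le> L0 * norm (x - y)" if "s \<in> {0..t}" for s x y
      using Lip[of t] by blast
    define L where "L = max L0 1"
    have Lpos: "L > 0" by (simp add: L_def)
    have L: "norm (f s x - f s y) \<le> L * norm (x - y)" if "s \<in> {0..t}" for s x y
    proof -
      have "L0 * norm (x - y) \<le> L * norm (x - y)"
        by (intro mult_right_mono) (auto simp: L_def)
      with L0[OF that, of x y] show ?thesis by linarith
    qed
    have "uniform_limit {0..t} (\<lambda>n s. f s (X n s)) (\<lambda>s. f s (x s)) sequentially"
    proof (rule uniform_limitI)
      fix e :: real assume "e > 0"
      then have "\<forall>\<^sub>F n in sequentially. \<forall>s\<in>{0..t}. dist (X n s) (x s) < e / L"
        using Lpos by (intro uniform_limitD[OF unif]) auto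
      then show "\<forall>\<^sub>F n in sequentially. \<forall>s\<in>{0..t}. dist (f s (X n s)) (f s (x s)) < e"
      proof (rule eventually_mono, intro ballI)
        fix n s assume n: "\<forall>s\<in>{0..t}. dist (X n s) (x s) < e / L" and s: "s \<in> {0..t}"
        have "dist (f s (X n s)) (f s (x s)) \<le> L * dist (X n s) (x s)"
          using L[OF s] by (simp add: dist_norm)
        also have "\<dots> < e" using n s Lpos by (simp add: field_simps)
        finally show "dist (f s (X n s)) (f s (x s)) < e" .
      qed
    qed
    then obtain I J where I: "\<And>n. ((\<lambda>s. f s (X n s)) has_integral I n) {0..t}"
        and J: "((\<lambda>s. f s (x s)) has_integral J) {0..t}" and IJ: "I \<longlonglongrightarrow> J"
      by (rule uniform_limit_integral[where ?F = sequentially])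
         (auto intro: continuous_on_subset[OF cont[OF contX]])
    have "(\<lambda>n. X (Suc n) t) \<longlonglongrightarrow> x0 + J"
      using IJ by (simp add: XS integral_unique[OF I] tendsto_intros)
    moreover have "(\<lambda>n. X (Suc n) t) \<longlonglongrightarrow> x t"
      using tendsto_uniform_limitI[OF unif, of t t] that by (intro LIMSEQ_Suc) auto
    ultimately show ?thesis using J by (auto simp: integral_unique dest: LIMSEQ_unique)
  qed
  have "(x has_vector_derivative f t (x t)) (at t within {0..})" if "t \<ge> 0" for t
  proof -
    have "((\<lambda>u. x0 + integral {0..u} (\<lambda>s. f s (x s))) has_vector_derivative 0 + f t (x t)) (at t within {0..})"
      by (intro has_vector_derivative_add integral_has_vector_derivative_Ici cont contx that) simp
    then have int: "((\<lambda>u. x0 + integral {0..u} (\<lambda>s. f s (x s))) has_vector_derivative f t (x t)) (at t within {0..})"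
      by simp
    show ?thesis
      by (rule has_vector_derivative_transform[OF _ x_eq int]) (use that in simp_all)
  qed
  moreover have "x 0 = x0" by (subst x_eq) simp_all
  ultimately show ?thesis by blast
qed

section \<open>The linear system: existence, Wronskian, nontrivial solutions\<close>

lemma continuous_on_Icc_abs_bound:
  fixes f :: "real \<Rightarrow> real"
  assumes "continuous_on {u..v} f"
  shows "\<exists>L. \<forall>s\<in>{u..v}. \<bar>f s\<bar> \<le> L"
proof -
  have "bounded (f ` {u..v})"
    using assms by (intro compact_imp_bounded compact_continuous_image) auto
  then show ?thesis by (auto simp: bounded_iff)
qed

text \<open>The equation \<open>\<phi>'' = (q + d') \<phi>\<close> as a system: with \<open>\<psi> = \<phi>' - d \<phi>\<close> no derivative of
  \<open>d\<close> occurs, and \<open>Z = \<phi>' / \<phi> = d + \<psi> / \<phi>\<close> solves \<open>dZ = (q - Z\<^sup>2) dt + dd\<close>.\<close>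

definition lin_sys :: "(real \<Rightarrow> real) \<Rightarrow> (real \<Rightarrow> real) \<Rightarrow> (real \<Rightarrow> real) \<Rightarrow> (real \<Rightarrow> real) \<Rightarrow> bool" where
  "lin_sys q d \<phi> \<psi> \<longleftrightarrow> (\<forall>t\<ge>0.
     (\<phi> has_real_derivative d t * \<phi> t + \<psi> t) (at t within {0..}) \<and>
     (\<psi> has_real_derivative (q t - (d t)\<^sup>2) * \<phi> t - d t * \<psi> t) (at t within {0..}))"

lemma lin_sysD:
  assumes "lin_sys q d \<phi> \<psi>" "t \<ge> 0"
  shows "(\<phi> has_real_derivative d t * \<phi> t + \<psi> t) (at t within {0..})"
    and "(\<psi> has_real_derivative (q t - (d t)\<^sup>2) * \<phi> t - d t * \<psi> t) (at t within {0..})"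
  using assms by (auto simp: lin_sys_def)

lemma lin_sys_continuous_on:
  assumes "lin_sys q d \<phi> \<psi>"
  shows "continuous_on {0..} \<phi>" "continuous_on {0..} \<psi>"
  using lin_sysD[OF assms] by (auto intro!: DERIV_continuous_on)

lemma lin_sys_lincomb:
  assumes "lin_sys q d \<phi> \<psi>" "lin_sys q d \<phi>' \<psi>'"
  shows "lin_sys q d (\<lambda>t. x * \<phi> t + y * \<phi>' t) (\<lambda>t. x * \<psi> t + y * \<psi>' t)"
  unfolding lin_sys_def
proof (intro allI impI)
  fix t :: real assume t: "t \<ge> 0"
  note D = lin_sysD[OF assms(1) t] lin_sysD[OF assms(2) t]
  show "((\<lambda>t. x * \<phi> t + y * \<phi>' t) has_real_derivative
          d t * (x * \<phi> t + y * \<phi>' t) + (x * \<psi> t + y * \<psi>' t)) (at t within {0..}) \<and>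
        ((\<lambda>t. x * \<psi> t + y * \<psi>' t) has_real_derivative
          (q t - (d t)\<^sup>2) * (x * \<phi> t + y * \<phi>' t) - d t * (x * \<psi> t + y * \<psi>' t)) (at t within {0..})"
    by (rule conjI; (rule derivative_eq_intros D refl)+; simp add: algebra_simps)
qed

text \<open>The coefficient matrix has trace d - d = 0, so the determinant of two solutions is
  conserved (Liouville). Below, this conservation does the work of a uniqueness theorem for the
  system.\<close>

lemma lin_sys_wronskian:
  assumes "lin_sys q d \<phi> \<psi>" "lin_sys q d \<phi>' \<psi>'" "t \<ge> 0"
  shows "\<phi> t * \<psi>' t - \<phi>' t * \<psi> t = \<phi> 0 * \<psi>' 0 - \<phi>' 0 * \<psi> 0"
proof -
  have "((\<lambda>t. \<phi> t * \<psi>' t - \<phi>' t * \<psi> t) has_real_derivative 0) (at t within {0..})" if "t \<ge> 0" for t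
    by (rule derivative_eq_intros lin_sysD[OF assms(1) that] lin_sysD[OF assms(2) that] refl)+
       (simp add: algebra_simps power2_eq_square)
  then have "\<exists>c. \<forall>t\<in>{0..}. \<phi> t * \<psi>' t - \<phi>' t * \<psi> t = c"
    by (intro has_field_derivative_zero_constant) auto
  then show ?thesis using assms(3) by (metis atLeast_iff order_refl)
qed

lemma lin_sys_exists_init0:
  assumes q: "continuous_on {0..} q" and d: "continuous_on {0..} d"
  shows "\<exists>\<phi> \<psi>. lin_sys q d \<phi> \<psi> \<and> \<phi> 0 = x0 \<and> \<psi> 0 = y0"
proof -
  define f where "f t x = (d t * fst x + snd x, (q t - (d t)\<^sup>2) * fst x - d t * snd x)" for t and x :: "real \<times> real"
  have "\<exists>x. x 0 = (x0, y0) \<and> (\<forall>t\<ge>0. (x has_vector_derivative f t (x t)) (at t within {0..}))"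
  proof (rule picard_lindelof_half_line)
    show "continuous_on {0..} (\<lambda>t. f t (x t))" if "continuous_on {0..} x" for x
      unfolding f_def by (intro continuous_intros that q d)
    fix T :: real
    obtain D where D: "\<And>t. t \<in> {0..T} \<Longrightarrow> \<bar>d t\<bar> \<le> D"
      using continuous_on_Icc_abs_bound[OF continuous_on_subset[OF d, of "{0..T}"]] by fastforce
    have "continuous_on {0..} (\<lambda>t. q t - (d t)\<^sup>2)" by (intro continuous_intros q d)
    then obtain Q where Q: "\<And>t. t \<in> {0..T} \<Longrightarrow> \<bar>q t - (d t)\<^sup>2\<bar> \<le> Q"
      using continuous_on_Icc_abs_bound[OF continuous_on_subset[of "{0..}" _ "{0..T}"]] by fastforce
    have "norm (f t x - f t y) \<le> (2 * D + 1 + Q) * norm (x - y)" if t: "t \<in> {0..T}" for t x y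
    proof -
      define u v where "u = fst x - fst y" and "v = snd x - snd y"
      have uv: "\<bar>u\<bar> \<le> norm (x - y)" "\<bar>v\<bar> \<le> norm (x - y)"
        unfolding u_def v_def real_norm_def[symmetric] fst_diff[symmetric] snd_diff[symmetric]
        by (metis norm_fst_le prod.collapse, metis norm_snd_le prod.collapse)
      have eq: "f t x - f t y = (d t * u + v, (q t - (d t)\<^sup>2) * u - d t * v)"
        by (simp add: f_def u_def v_def algebra_simps)
      have "norm (f t x - f t y) \<le> \<bar>d t * u + v\<bar> + \<bar>(q t - (d t)\<^sup>2) * u - d t * v\<bar>"
        unfolding eq using norm_Pair_le[of "d t * u + v" "(q t - (d t)\<^sup>2) * u - d t * v"] by simp
      also have "\<dots> \<le> \<bar>d t\<bar> * \<bar>u\<bar> + \<bar>v\<bar> + (\<bar>q t - (d t)\<^sup>2\<bar> * \<bar>u\<bar> + \<bar>d t\<bar> * \<bar>v\<bar>)"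
        by (intro add_mono order_trans[OF abs_triangle_ineq] order_trans[OF abs_triangle_ineq4]) (simp_all add: abs_mult)
      also have "\<dots> \<le> D * norm (x - y) + norm (x - y) + (Q * norm (x - y) + D * norm (x - y))"
        using D[OF t] Q[OF t] uv by (intro add_mono mult_mono) auto
      finally show ?thesis by (simp add: algebra_simps)
    qed
    then show "\<exists>L. \<forall>t\<in>{0..T}. \<forall>x y. norm (f t x - f t y) \<le> L * norm (x - y)" by blast
  qed
  then obtain x where x0: "x 0 = (x0, y0)"
    and x: "\<And>t. t \<ge> 0 \<Longrightarrow> (x has_vector_derivative f t (x t)) (at t within {0..})" by blast
  have "lin_sys q d (fst \<circ> x) (snd \<circ> x)"
    unfolding lin_sys_def has_real_derivative_iff_has_vector_derivative
  proof (intro allI impI conjI)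
    fix t :: real assume "t \<ge> 0"
    from bounded_linear.has_vector_derivative[OF bounded_linear_fst x[OF this]]
      bounded_linear.has_vector_derivative[OF bounded_linear_snd x[OF this]]
    show "(fst \<circ> x has_vector_derivative d t * (fst \<circ> x) t + (snd \<circ> x) t) (at t within {0..})"
      "(snd \<circ> x has_vector_derivative (q t - (d t)\<^sup>2) * (fst \<circ> x) t - d t * (snd \<circ> x) t) (at t within {0..})"
      by (simp_all add: f_def o_def)
  qed
  then show ?thesis using x0 by (intro exI[of _ "fst \<circ> x"] exI[of _ "snd \<circ> x"]) auto
qed

lemma lin_sys_fundamental:
  assumes "continuous_on {0..} q" "continuous_on {0..} d"
  obtains \<phi>1 \<psi>1 \<phi>2 \<psi>2 where "lin_sys q d \<phi>1 \<psi>1" "lin_sys q d \<phi>2 \<psi>2"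
    "\<And>t. t \<ge> 0 \<Longrightarrow> \<phi>1 t * \<psi>2 t - \<phi>2 t * \<psi>1 t = 1"
proof -
  obtain \<phi>1 \<psi>1 where 1: "lin_sys q d \<phi>1 \<psi>1" "\<phi>1 0 = 1" "\<psi>1 0 = 0"
    using lin_sys_exists_init0[OF assms] by blast
  obtain \<phi>2 \<psi>2 where 2: "lin_sys q d \<phi>2 \<psi>2" "\<phi>2 0 = 0" "\<psi>2 0 = 1"
    using lin_sys_exists_init0[OF assms] by blast
  show ?thesis
    using that[OF 1(1) 2(1)] lin_sys_wronskian[OF 1(1) 2(1)] 1 2 by simp
qed

lemma lin_sys_exists:
  assumes "continuous_on {0..} q" "continuous_on {0..} d" "t0 \<ge> 0"
  shows "\<exists>\<phi> \<psi>. lin_sys q d \<phi> \<psi> \<and> \<phi> t0 = x0 \<and> \<psi> t0 = y0"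
proof -
  obtain \<phi>1 \<psi>1 \<phi>2 \<psi>2 where 1: "lin_sys q d \<phi>1 \<psi>1" and 2: "lin_sys q d \<phi>2 \<psi>2"
    and W: "\<And>t. t \<ge> 0 \<Longrightarrow> \<phi>1 t * \<psi>2 t - \<phi>2 t * \<psi>1 t = 1"
    using lin_sys_fundamental[OF assms(1,2)] by metis
  \<comment> \<open>Cramer's rule with determinant 1. Data prescribed at t0 are thus reached without
    solving the system backward from t0 to 0.\<close>
  define x y where "x = x0 * \<psi>2 t0 - y0 * \<phi>2 t0" and "y = y0 * \<phi>1 t0 - x0 * \<psi>1 t0"
  have "x * \<phi>1 t0 + y * \<phi>2 t0 = x0 * (\<phi>1 t0 * \<psi>2 t0 - \<phi>2 t0 * \<psi>1 t0)"
    "x * \<psi>1 t0 + y * \<psi>2 t0 = y0 * (\<phi>1 t0 * \<psi>2 t0 - \<phi>2 t0 * \<psi>1 t0)"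
    by (simp_all add: x_def y_def algebra_simps)
  then show ?thesis
    using lin_sys_lincomb[OF 1 2, of x y] W[OF assms(3)]
    by (intro exI[of _ "\<lambda>t. x * \<phi>1 t + y * \<phi>2 t"] exI[of _ "\<lambda>t. x * \<psi>1 t + y * \<psi>2 t"]) simp
qed

lemma lin_sys_nontrivial:
  assumes "continuous_on {0..} q" "continuous_on {0..} d" "lin_sys q d \<phi> \<psi>"
    and "t0 \<ge> 0" "\<phi> t0 \<noteq> 0 \<or> \<psi> t0 \<noteq> 0" "t \<ge> 0"
  shows "\<phi> t \<noteq> 0 \<or> \<psi> t \<noteq> 0"
proof -
  \<comment> \<open>The companion starts from the data turned by a right angle, which makes the
    Wronskian at t0 equal to \<phi>^2 + \<psi>^2. If both components vanished at t, it would be 0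
    there.\<close>
  obtain \<phi>' \<psi>' where 2: "lin_sys q d \<phi>' \<psi>'" "\<phi>' t0 = - \<psi> t0" "\<psi>' t0 = \<phi> t0"
    using lin_sys_exists[OF assms(1,2,4)] by blast
  have "\<phi> t0 * \<phi> t0 + \<psi> t0 * \<psi> t0 \<noteq> 0" using assms(5) sum_squares_eq_zero_iff by blast
  then show ?thesis
    using lin_sys_wronskian[OF assms(3) 2(1) assms(4)] lin_sys_wronskian[OF assms(3) 2(1) assms(6)] 2
    by auto
qed

text \<open>Proportionality is expressed by zero set and quotient because these are all that a path
  sees of a solution. At a common zero the quotients agree by the convention x / 0 = 0.\<close>

lemma lin_sys_proportional:
  assumes "continuous_on {0..} q" "continuous_on {0..} d" "lin_sys q d \<phi> \<psi>" "lin_sys q d \<phi>' \<psi>'"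
    and "\<phi> 0 * \<psi>' 0 - \<phi>' 0 * \<psi> 0 = 0" "\<phi> 0 \<noteq> 0 \<or> \<psi> 0 \<noteq> 0" "\<phi>' 0 \<noteq> 0 \<or> \<psi>' 0 \<noteq> 0" "t \<ge> 0"
  shows "\<phi> t = 0 \<longleftrightarrow> \<phi>' t = 0" "\<psi> t / \<phi> t = \<psi>' t / \<phi>' t"
proof -
  have W: "\<phi> t * \<psi>' t = \<phi>' t * \<psi> t"
    using lin_sys_wronskian[OF assms(3,4,8)] assms(5) by simp
  have n: "\<phi> t \<noteq> 0 \<or> \<psi> t \<noteq> 0" "\<phi>' t \<noteq> 0 \<or> \<psi>' t \<noteq> 0"
    using lin_sys_nontrivial[OF assms(1-3) _ assms(6,8)] lin_sys_nontrivial[OF assms(1,2,4) _ assms(7,8)] by auto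
  show 1: "\<phi> t = 0 \<longleftrightarrow> \<phi>' t = 0" using W n by auto
  show "\<psi> t / \<phi> t = \<psi>' t / \<phi>' t"
    using W 1 by (cases "\<phi> t = 0") (auto simp: field_simps)
qed

section \<open>Riccati paths as quotients of linear solutions\<close>

lemma gronwall_zero:
  fixes m :: "real \<Rightarrow> real"
  assumes "u \<le> v" and cont: "continuous_on {u..v} m"
    and der: "\<And>s. u < s \<Longrightarrow> s < v \<Longrightarrow> \<exists>m'. (m has_real_derivative m') (at s) \<and> \<bar>m'\<bar> \<le> L * \<bar>m s\<bar>"
    and zero: "m u = 0 \<or> m v = 0" and s: "s \<in> {u..v}"
  shows "m s = 0"
proof -
  \<comment> \<open>The hypothesis confines the derivative of m^2 to [-2 L m^2, 2 L m^2]. So f is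
    nonincreasing for c = -2 L, which carries a zero to the right, and nondecreasing for c = 2 L,
    which carries a zero to the left.\<close>
  define f where "f c r = exp (c * r) * (m r)\<^sup>2" for c r
  have df: "\<exists>y. (f c has_real_derivative y) (at r) \<and> \<bar>y - c * f c r\<bar> \<le> 2 * L * f c r"
    if r: "u < r" "r < v" for c r
  proof -
    obtain m' where m': "(m has_real_derivative m') (at r)" "\<bar>m'\<bar> \<le> L * \<bar>m r\<bar>"
      using der[OF r] by blast
    have "(f c has_real_derivative c * f c r + exp (c * r) * (2 * (m r * m'))) (at r)"
      unfolding f_def[abs_def] by (rule derivative_eq_intros m'(1) refl)+ (simp add: algebra_simps)
    moreover have "\<bar>exp (c * r) * (2 * (m r * m'))\<bar> = exp (c * r) * (2 * (\<bar>m r\<bar> * \<bar>m'\<bar>))"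
      by (simp add: abs_mult)
    moreover have "exp (c * r) * (2 * (\<bar>m r\<bar> * \<bar>m'\<bar>)) \<le> exp (c * r) * (2 * (\<bar>m r\<bar> * (L * \<bar>m r\<bar>)))"
      by (intro mult_left_mono m'(2)) auto
    moreover have "\<dots> = 2 * L * f c r" by (simp add: f_def power2_eq_square)
    ultimately show ?thesis
      by (intro exI[of _ "c * f c r + exp (c * r) * (2 * (m r * m'))"] conjI) (assumption, linarith)
  qed
  have cf: "continuous_on {x..y} (f c)" if "u \<le> x" "y \<le> v" for c x y
    unfolding f_def[abs_def] using that by (intro continuous_intros continuous_on_subset[OF cont]) auto
  have f0: "m r = 0" if "f c r \<le> 0" for c r
    using that by (simp add: f_def mult_le_0_iff)
  from zero show ?thesis
  proof
    assume 0: "m u = 0"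
    have "f (- (2 * L)) s \<le> f (- (2 * L)) u"
    proof (rule DERIV_nonpos_imp_decreasing_open[where f = "f (- (2 * L))"])
      fix r assume "u < r" "r < s"
      with df[of r "- (2 * L)"] s obtain y where "(f (- (2 * L)) has_real_derivative y) (at r)"
        "\<bar>y - - (2 * L) * f (- (2 * L)) r\<bar> \<le> 2 * L * f (- (2 * L)) r" by force
      then show "\<exists>y. (f (- (2 * L)) has_real_derivative y) (at r) \<and> y \<le> 0"
        by (intro exI[of _ y] conjI) (assumption, linarith)
    qed (use s cf in auto)
    then show ?thesis using 0 by (intro f0[of "- (2 * L)"]) (simp add: f_def)
  next
    assume 0: "m v = 0"
    have "f (2 * L) s \<le> f (2 * L) v"
    proof (rule DERIV_nonneg_imp_increasing_open[where f = "f (2 * L)"])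
      fix r assume "s < r" "r < v"
      with df[of r "2 * L"] s obtain y where "(f (2 * L) has_real_derivative y) (at r)"
        "\<bar>y - 2 * L * f (2 * L) r\<bar> \<le> 2 * L * f (2 * L) r" by force
      then show "\<exists>y. (f (2 * L) has_real_derivative y) (at r) \<and> 0 \<le> y"
        by (intro exI[of _ y] conjI) (assumption, linarith)
    qed (use s cf in auto)
    then show ?thesis using 0 by (intro f0[of "2 * L"]) (simp add: f_def)
  qed
qed

text \<open>The exceptional time is meant to be a restart, where m is known only to be continuous. A
  zero is carried up to t on one side and away from it on the other.\<close>

lemma gronwall_zero_except:
  fixes m :: "real \<Rightarrow> real"
  assumes cont: "continuous_on {u..v} m"
    and der: "\<And>s. u < s \<Longrightarrow> s < v \<Longrightarrow> s \<noteq> t \<Longrightarrow>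
      \<exists>m'. (m has_real_derivative m') (at s) \<and> \<bar>m'\<bar> \<le> L * \<bar>m s\<bar>"
    and x: "x \<in> {u..v}" and y: "y \<in> {u..v}" and 0: "m x = 0"
  shows "m y = 0"
proof -
  have step: "m p = 0 \<longleftrightarrow> m q = 0" if "u \<le> p" "p \<le> q" "q \<le> v" "t \<le> p \<or> q \<le> t" for p q
  proof -
    have *: "m s = 0" if "m p = 0 \<or> m q = 0" "s \<in> {p..q}" for s
    proof (rule gronwall_zero[of p q m L])
      show "continuous_on {p..q} m"
        using cont by (rule continuous_on_subset) (use \<open>u \<le> p\<close> \<open>q \<le> v\<close> in auto)
      show "\<exists>m'. (m has_real_derivative m') (at r) \<and> \<bar>m'\<bar> \<le> L * \<bar>m r\<bar>" if "p < r" "r < q" for r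
        using der[of r] that \<open>u \<le> p\<close> \<open>q \<le> v\<close> \<open>t \<le> p \<or> q \<le> t\<close> by auto
    qed (use that \<open>p \<le> q\<close> in auto)
    show ?thesis using *[of p] *[of q] \<open>p \<le> q\<close> by (metis atLeastAtMost_iff order_refl)
  qed
  consider "x \<le> y" "t \<le> x \<or> y \<le> t" | "y \<le> x" "t \<le> y \<or> x \<le> t"
    | "x \<le> t" "t \<le> y" | "y \<le> t" "t \<le> x"
    using linear[of x y] linear[of t x] linear[of t y] by blast
  then have "m x = 0 \<longleftrightarrow> m y = 0"
  proof cases
    case 1 show ?thesis by (rule step) (use 1 x y in auto)
  next
    case 2 show ?thesis by (rule step[symmetric]) (use 2 x y in auto)
  next
    case 3
    have "m x = 0 \<longleftrightarrow> m t = 0" by (rule step) (use 3 x y in auto)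
    also have "\<dots> \<longleftrightarrow> m y = 0" by (rule step) (use 3 x y in auto)
    finally show ?thesis .
  next
    case 4
    have "m y = 0 \<longleftrightarrow> m t = 0" by (rule step) (use 4 x y in auto)
    also have "\<dots> \<longleftrightarrow> m x = 0" by (rule step) (use 4 x y in auto)
    finally show ?thesis ..
  qed
  with 0 show ?thesis by simp
qed

text \<open>An affine chart of the projective line, translated by b. The parameter \<open>jv\<close>
  names the point at infinity, so that one linear solution yields a forward and a backward
  path.\<close>

definition lin_path :: "ereal \<Rightarrow> (real \<Rightarrow> real) \<Rightarrow> (real \<Rightarrow> real) \<Rightarrow> (real \<Rightarrow> real) \<Rightarrow> real \<Rightarrow> ereal" where
  "lin_path jv b \<phi> \<psi> t = (if \<phi> t = 0 then jv else ereal (b t + \<psi> t / \<phi> t))"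

text \<open>Eventual finiteness is required because \<open>real_of_ereal\<close> sends infinite
  values to 0.\<close>

lemma real_of_ereal_at_top:
  assumes "(Z \<longlongrightarrow> \<infinity>) F" "\<forall>\<^sub>F s in F. Z s \<noteq> \<infinity> \<and> Z s \<noteq> -\<infinity>"
  shows "filterlim (\<lambda>s. real_of_ereal (Z s)) at_top F"
  unfolding filterlim_at_top_dense
proof
  fix r
  have "\<forall>\<^sub>F s in F. ereal r < Z s" using assms(1) by (simp add: tendsto_PInfty)
  then show "\<forall>\<^sub>F s in F. r < real_of_ereal (Z s)"
    using assms(2)
  proof eventually_elim
    case (elim s)
    then show ?case by (cases "Z s") auto
  qed
qed

lemma real_of_ereal_at_bot:
  assumes "(Z \<longlongrightarrow> -\<infinity>) F" "\<forall>\<^sub>F s in F. Z s \<noteq> \<infinity> \<and> Z s \<noteq> -\<infinity>"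
  shows "filterlim (\<lambda>s. real_of_ereal (Z s)) at_bot F"
  unfolding filterlim_at_bot_dense
proof
  fix r
  have "\<forall>\<^sub>F s in F. Z s < ereal r" using assms(1) by (simp add: tendsto_MInfty)
  then show "\<forall>\<^sub>F s in F. real_of_ereal (Z s) < r"
    using assms(2)
  proof eventually_elim
    case (elim s)
    then show ?case by (cases "Z s") auto
  qed
qed

lemma at_within_Ici_interior: "c < s \<Longrightarrow> at s within {c..} = at (s::real)"
  by (rule at_within_interior) simp

lemma lin_sys_derivs_at:
  assumes "lin_sys q d \<phi> \<psi>" "t > 0"
  shows "(\<phi> has_real_derivative d t * \<phi> t + \<psi> t) (at t)"
    and "(\<psi> has_real_derivative (q t - (d t)\<^sup>2) * \<phi> t - d t * \<psi> t) (at t)"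
  using lin_sysD[OF assms(1), of t] assms(2) by (simp_all add: at_within_Ici_interior)

text \<open>Write \<open>y = Z - b\<close>. Where \<open>Z\<close> is finite, the defect \<open>\<psi> - y \<phi>\<close> solves a homogeneous linear
  equation with bounded coefficient; around a restart time \<open>\<psi> / y - \<phi>\<close> does, extended
  continuously by \<open>- \<phi>\<close> at the restart itself.\<close>

lemma riccati_path_lin_path_local:
  assumes Z: "riccati_path \<beta> a b {t0..} jv Z" and t0: "0 \<le> t0" and b: "continuous_on {0..} b"
    and jv: "jv = \<infinity> \<or> jv = -\<infinity>"
    and lin: "lin_sys (\<lambda>t. a + \<beta> / 4 * t) b \<phi> \<psi>"
    and nz: "\<And>s. s \<ge> 0 \<Longrightarrow> \<phi> s \<noteq> 0 \<or> \<psi> s \<noteq> 0"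
    and t: "t \<ge> t0"
  shows "\<exists>T. openin (top_of_set {t0..}) T \<and> t \<in> T \<and>
    (\<forall>x\<in>T. \<forall>y\<in>T. Z x = lin_path jv b \<phi> \<psi> x \<longrightarrow> Z y = lin_path jv b \<phi> \<psi> y)"
proof -
  define c where "c s = a + \<beta> / 4 * s" for s
  define y where "y s = real_of_ereal (Z s) - b s" for s
  note [continuous_intros] = continuous_on_subset[OF b]
    continuous_on_subset[OF lin_sys_continuous_on(1)[OF lin]]
    continuous_on_subset[OF lin_sys_continuous_on(2)[OF lin]]
  have dy: "(y has_real_derivative c s - (y s + b s)\<^sup>2) (at s within {t0..})"
    if "s \<ge> t0" "Z s \<noteq> \<infinity> \<and> Z s \<noteq> -\<infinity>" for s
    using Z that jv unfolding riccati_path_def y_def c_def by auto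
  have openin: "openin (top_of_set {t0..}) ({t0..} \<inter> {t-\<delta><..<t+\<delta>})" for \<delta>
    by (intro openin_open_Int) auto
  consider (fin) "Z t \<noteq> \<infinity> \<and> Z t \<noteq> -\<infinity>" "\<exists>\<delta>>0. \<forall>s\<in>{t0..}. \<bar>s - t\<bar> < \<delta> \<longrightarrow> Z s \<noteq> \<infinity> \<and> Z s \<noteq> -\<infinity>"
    | (jump) "Z t = jv" "\<exists>\<delta>>0. \<forall>s\<in>{t0..}. 0 < \<bar>s - t\<bar> \<and> \<bar>s - t\<bar> < \<delta> \<longrightarrow> Z s \<noteq> \<infinity> \<and> Z s \<noteq> -\<infinity>"
      "(Z \<longlongrightarrow> \<infinity>) (at t within ({t0..} \<inter> {t<..}))" "(Z \<longlongrightarrow> -\<infinity>) (at t within ({t0..} \<inter> {..<t}))"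
    using Z t unfolding riccati_path_def by blast
  then show ?thesis
  proof cases
    case fin
    then obtain \<delta> where \<delta>: "\<delta> > 0" "\<And>s. s \<ge> t0 \<Longrightarrow> \<bar>s - t\<bar> < \<delta> \<Longrightarrow> Z s \<noteq> \<infinity> \<and> Z s \<noteq> -\<infinity>"
      by auto
    \<comment> \<open>Halving \<delta> leaves a compact interval inside the region where Z is
      finite, which bounds the coefficient. The cut at t0 covers the case that t is the left
      endpoint.\<close>
    define u v where "u = max t0 (t - \<delta>/2)" and "v = t + \<delta>/2"
    have uv: "s \<ge> t0" "\<bar>s - t\<bar> < \<delta>" if "s \<in> {u..v}" for s
      using that \<delta>(1) by (auto simp: u_def v_def abs_if max_def split: if_splits)
    have fin: "Z s \<noteq> \<infinity> \<and> Z s \<noteq> -\<infinity>" if "s \<in> {u..v}" for s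
      using \<delta>(2) uv that by blast
    have dy': "(y has_real_derivative c s - (y s + b s)\<^sup>2) (at s within {t0..})" if "s \<in> {u..v}" for s
      using dy fin uv that by blast
    have cy [continuous_intros]: "continuous_on {u..v} y"
      by (rule DERIV_continuous_on[OF DERIV_subset[OF dy']]) (use uv in auto)
    have sub: "{u..v} \<subseteq> {0..}" using t0 uv by force
    have "continuous_on {u..v} (\<lambda>s. y s + b s)"
      by (intro continuous_intros sub)
    from continuous_on_Icc_abs_bound[OF this] obtain L where L: "\<And>s. s \<in> {u..v} \<Longrightarrow> \<bar>y s + b s\<bar> \<le> L"
      by blast
    \<comment> \<open>At a zero of \<phi> both sides are false: \<open>lin_path\<close> is infinite
      while Z is finite, and the defect is \<psi>, nonzero by \<open>nz\<close>.\<close>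
    have agree: "Z s = lin_path jv b \<phi> \<psi> s \<longleftrightarrow> \<psi> s - y s * \<phi> s = 0" if "s \<in> {u..v}" for s
    proof -
      have Zs: "Z s = ereal (b s + y s)" using fin[OF that] by (cases "Z s") (auto simp: y_def)
      show ?thesis
        using nz[of s] sub that jv unfolding Zs lin_path_def by (auto simp: field_simps)
    qed
    have "\<psi> z - y z * \<phi> z = 0" if "x \<in> {u..v}" "z \<in> {u..v}" "\<psi> x - y x * \<phi> x = 0" for x z
    proof (rule gronwall_zero_except[where m = "\<lambda>s. \<psi> s - y s * \<phi> s" and t = t and L = L])
      show "continuous_on {u..v} (\<lambda>s. \<psi> s - y s * \<phi> s)"
        by (intro continuous_intros sub)
      fix s assume s: "u < s" "s < v"
      then have s': "t0 < s" "0 < s" "s \<in> {u..v}" using t0 by (auto simp: u_def)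
      have "(y has_real_derivative c s - (y s + b s)\<^sup>2) (at s)"
        using dy'[of s] s' by (simp add: at_within_Ici_interior)
      note D = this lin_sys_derivs_at[OF lin s'(2)]
      have "((\<lambda>s. \<psi> s - y s * \<phi> s) has_real_derivative - (y s + b s) * (\<psi> s - y s * \<phi> s)) (at s)"
        by (rule derivative_eq_intros D refl)+ (simp add: c_def algebra_simps power2_eq_square)
      moreover have "\<bar>- (y s + b s) * (\<psi> s - y s * \<phi> s)\<bar> \<le> L * \<bar>\<psi> s - y s * \<phi> s\<bar>"
        using L[OF s'(3)] by (simp add: abs_mult mult_right_mono abs_minus_commute)
      ultimately show "\<exists>m'. ((\<lambda>s. \<psi> s - y s * \<phi> s) has_real_derivative m') (at s) \<and>
          \<bar>m'\<bar> \<le> L * \<bar>\<psi> s - y s * \<phi> s\<bar>" by blast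
    qed (use that in auto)
    with agree have conn: "Z z = lin_path jv b \<phi> \<psi> z"
      if "x \<in> {u..v}" "z \<in> {u..v}" "Z x = lin_path jv b \<phi> \<psi> x" for x z
      using that by blast
    have "{t0..} \<inter> {t-\<delta>/2<..<t+\<delta>/2} \<subseteq> {u..v}" by (auto simp: u_def v_def)
    with conn show ?thesis
      using \<delta>(1) t by (intro exI[of _ "{t0..} \<inter> {t-\<delta>/2<..<t+\<delta>/2}"] conjI openin) (simp, blast)
  next
    case jump
    then obtain \<delta>0 where \<delta>0: "\<delta>0 > 0"
      "\<forall>s\<in>{t0..}. 0 < \<bar>s - t\<bar> \<and> \<bar>s - t\<bar> < \<delta>0 \<longrightarrow> Z s \<noteq> \<infinity> \<and> Z s \<noteq> -\<infinity>"
      by blast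
    have \<delta>0': "Z s \<noteq> \<infinity> \<and> Z s \<noteq> -\<infinity>" if "s \<ge> t0" "s \<noteq> t" "\<bar>s - t\<bar> < \<delta>0" for s
      using \<delta>0(2) that by auto
    have evfin: "\<forall>\<^sub>F s in at t within S. Z s \<noteq> \<infinity> \<and> Z s \<noteq> -\<infinity>" if "S \<subseteq> {t0..}" for S
      unfolding eventually_at using \<delta>0(1) \<delta>0' that by (intro exI[of _ \<delta>0]) (auto simp: dist_real_def)
    have bt: "(b \<longlongrightarrow> b t) (at t within {t0..})"
      using b t t0 by (auto simp: continuous_on_def intro: tendsto_within_subset)
    have split: "at t within {t0..} = sup (at t within ({t0..} \<inter> {t<..})) (at t within ({t0..} \<inter> {..<t}))"
      unfolding filter_eq_iff eventually_sup eventually_at_filter eventually_conj_iff[symmetric]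
      by (intro allI arg_cong[where f = "\<lambda>P. eventually P _"]) auto
    \<comment> \<open>The two one-sided limits have opposite signs, so only the modulus of y has a
      two-sided limit. At t = t0 the left-hand filter is trivial.\<close>
    have yinf: "filterlim y at_infinity (at t within {t0..})"
      unfolding split y_def diff_conv_add_uminus
      add.commute[of _ "- b _"]
    proof (intro filterlim_sup tendsto_add_filterlim_at_infinity)
      show "((\<lambda>s. - b s) \<longlongrightarrow> - b t) (at t within ({t0..} \<inter> {t<..}))"
        "((\<lambda>s. - b s) \<longlongrightarrow> - b t) (at t within ({t0..} \<inter> {..<t}))"
        by (rule tendsto_minus[OF tendsto_within_subset[OF bt]], simp)+
      show "filterlim (\<lambda>s. real_of_ereal (Z s)) at_infinity (at t within ({t0..} \<inter> {t<..}))"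
        by (intro filterlim_at_top_imp_at_infinity real_of_ereal_at_top jump evfin) auto
      show "filterlim (\<lambda>s. real_of_ereal (Z s)) at_infinity (at t within ({t0..} \<inter> {..<t}))"
        by (intro filterlim_at_bot_imp_at_infinity real_of_ereal_at_bot jump evfin) auto
    qed
    have "\<forall>\<^sub>F s in at t within {t0..}. 1 \<le> norm (y s)"
      using yinf by (simp add: filterlim_at_infinity[of 0])
    then obtain \<delta>1 where \<delta>1: "\<delta>1 > 0" "\<And>s. s \<ge> t0 \<Longrightarrow> s \<noteq> t \<Longrightarrow> \<bar>s - t\<bar> < \<delta>1 \<Longrightarrow> 1 \<le> \<bar>y s\<bar>"
      unfolding eventually_at by (auto simp: dist_real_def)
    define \<delta> where "\<delta> = min \<delta>0 \<delta>1"
    have \<delta>: "\<delta> > 0" using \<delta>0 \<delta>1 by (simp add: \<delta>_def)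
    define u v where "u = max t0 (t - \<delta>/2)" and "v = t + \<delta>/2"
    have uv: "s \<ge> t0" "\<bar>s - t\<bar> < \<delta>" if "s \<in> {u..v}" for s
      using that \<delta> by (auto simp: u_def v_def abs_if max_def split: if_splits)
    have fin: "Z s \<noteq> \<infinity> \<and> Z s \<noteq> -\<infinity>" "1 \<le> \<bar>y s\<bar>" if "s \<in> {u..v}" "s \<noteq> t" for s
      using \<delta>0'[of s] \<delta>1(2)[of s] uv[OF that(1)] that(2) by (auto simp: \<delta>_def)
    have dy': "(y has_real_derivative c s - (y s + b s)\<^sup>2) (at s within {t0..})" if "s \<in> {u..v}" "s \<noteq> t" for s
      using dy fin uv that by blast
    have sub: "{u..v} \<subseteq> {0..}" using t0 uv by force
    define V where "V s = (if s = t then 0 else inverse (y s))" for s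
    have cV [continuous_intros]: "continuous_on {u..v} V"
      unfolding continuous_on_def
    proof
      fix s assume s: "s \<in> {u..v}"
      have "(V \<longlongrightarrow> V s) (at s within {t0..})"
      proof (cases "s = t")
        case True
        have "((\<lambda>s. inverse (y s)) \<longlongrightarrow> 0) (at t within {t0..})"
          by (rule filterlim_compose[OF tendsto_inverse_0 yinf])
        moreover have "\<forall>\<^sub>F s in at t within {t0..}. inverse (y s) = V s"
          using eventually_neq_at_within by eventually_elim (auto simp: V_def)
        ultimately have "(V \<longlongrightarrow> 0) (at t within {t0..})" by (rule Lim_transform_eventually)
        then show ?thesis using True by (simp add: V_def)
      next
        case False
        have "(y \<longlongrightarrow> y s) (at s within {t0..})"
          using DERIV_isCont dy'[OF s False] by (metis DERIV_continuous continuous_within)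
        then have "((\<lambda>s. inverse (y s)) \<longlongrightarrow> inverse (y s)) (at s within {t0..})"
          using fin(2)[OF s False] by (intro tendsto_inverse) auto
        moreover have "\<forall>\<^sub>F s in at s within {t0..}. inverse (y s) = V s"
          using eventually_neq_at_within[of t s] by eventually_elim (use False in \<open>auto simp: V_def\<close>)
        ultimately show ?thesis using False unfolding V_def by (auto intro: Lim_transform_eventually)
      qed
      then show "(V \<longlongrightarrow> V s) (at s within {u..v})"
        by (rule tendsto_within_subset) (use uv in auto)
    qed
    \<comment> \<open>The coefficient in m' = k m, obtained from V' = (1 + b V)^2 - c V^2. It
      contains V but not y, so it is continuous, and therefore bounded, across the restart.\<close>
    define k where "k s = b s + ((b s)\<^sup>2 - c s) * V s" for s
    have "continuous_on {u..v} k"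
      unfolding k_def[abs_def] c_def by (intro continuous_intros sub)
    from continuous_on_Icc_abs_bound[OF this] obtain L where L: "\<And>s. s \<in> {u..v} \<Longrightarrow> \<bar>k s\<bar> \<le> L"
      by blast
    define m where "m s = \<psi> s * V s - \<phi> s" for s
    have agree: "Z s = lin_path jv b \<phi> \<psi> s \<longleftrightarrow> m s = 0" if "s \<in> {u..v}" for s
    proof (cases "s = t")
      case True
      then show ?thesis using jump(1) jv by (auto simp: lin_path_def m_def V_def)
    next
      case False
      have Zs: "Z s = ereal (b s + y s)" using fin[OF that False] by (cases "Z s") (auto simp: y_def)
      have "y s \<noteq> 0" using fin[OF that False] by auto
      then show ?thesis
        using nz[of s] sub that jv False unfolding Zs lin_path_def m_def V_def by (auto simp: field_simps)
    qed
    have "m z = 0" if "x \<in> {u..v}" "z \<in> {u..v}" "m x = 0" for x z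
    proof (rule gronwall_zero_except[where m = m and t = t and L = L])
      show "continuous_on {u..v} m"
        unfolding m_def[abs_def] by (intro continuous_intros sub)
      fix s assume s: "u < s" "s < v" "s \<noteq> t"
      then have s': "t0 < s" "0 < s" "s \<in> {u..v}" using t0 by (auto simp: u_def)
      have y0: "y s \<noteq> 0" using fin[OF s'(3) s(3)] by auto
      have "(y has_real_derivative c s - (y s + b s)\<^sup>2) (at s)"
        using dy'[of s] s' s(3) by (simp add: at_within_Ici_interior)
      note D = this lin_sys_derivs_at[OF lin s'(2)]
      have "((\<lambda>s. \<psi> s * inverse (y s) - \<phi> s) has_real_derivative k s * m s) (at s)"
        by (rule derivative_eq_intros D y0 refl)+
           (use y0 s(3) in \<open>simp add: k_def c_def m_def V_def field_simps power2_eq_square\<close>)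
      then have "(m has_real_derivative k s * m s) (at s)"
        by (rule has_field_derivative_transform_within_open[of _ _ _ "- {t}"])
           (use s(3) in \<open>auto simp: m_def V_def\<close>)
      moreover have "\<bar>k s * m s\<bar> \<le> L * \<bar>m s\<bar>"
        using L[OF s'(3)] by (simp add: abs_mult mult_right_mono)
      ultimately show "\<exists>m'. (m has_real_derivative m') (at s) \<and> \<bar>m'\<bar> \<le> L * \<bar>m s\<bar>" by blast
    qed (use that in auto)
    with agree have conn: "Z z = lin_path jv b \<phi> \<psi> z"
      if "x \<in> {u..v}" "z \<in> {u..v}" "Z x = lin_path jv b \<phi> \<psi> x" for x z
      using that by blast
    have "{t0..} \<inter> {t-\<delta>/2<..<t+\<delta>/2} \<subseteq> {u..v}" by (auto simp: u_def v_def)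
    with conn show ?thesis
      using \<delta> t by (intro exI[of _ "{t0..} \<inter> {t-\<delta>/2<..<t+\<delta>/2}"] conjI openin) (simp, blast)
  qed
qed

lemma riccati_path_eq_lin_path:
  assumes Z: "riccati_path \<beta> a b {t0..} jv Z" and t0: "0 \<le> t0" and b: "continuous_on {0..} b"
    and jv: "jv = \<infinity> \<or> jv = -\<infinity>"
  obtains \<phi> \<psi> where "lin_sys (\<lambda>t. a + \<beta> / 4 * t) b \<phi> \<psi>" "\<And>t. t \<ge> 0 \<Longrightarrow> \<phi> t \<noteq> 0 \<or> \<psi> t \<noteq> 0"
    "\<And>t. t \<ge> t0 \<Longrightarrow> Z t = lin_path jv b \<phi> \<psi> t"
proof -
  \<comment> \<open>The pair (0, 1) represents the restart value, and (1, Z - b) represents a finite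
    value of Z.\<close>
  define x0 y0 where "x0 = (if Z t0 = jv then 0 else 1 :: real)"
    and "y0 = (if Z t0 = jv then 1 else real_of_ereal (Z t0) - b t0)"
  have q: "continuous_on {0..} (\<lambda>t. a + \<beta> / 4 * t)" by (intro continuous_intros)
  obtain \<phi> \<psi> where lin: "lin_sys (\<lambda>t. a + \<beta> / 4 * t) b \<phi> \<psi>" and init: "\<phi> t0 = x0" "\<psi> t0 = y0"
    using lin_sys_exists[OF q b t0] by blast
  have nz: "\<phi> t \<noteq> 0 \<or> \<psi> t \<noteq> 0" if "t \<ge> 0" for t
    by (rule lin_sys_nontrivial[OF q b lin t0 _ that]) (auto simp: init x0_def y0_def)
  have *: "Z t0 \<noteq> jv \<longrightarrow> Z t0 \<noteq> \<infinity> \<and> Z t0 \<noteq> -\<infinity>"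
    using Z unfolding riccati_path_def by auto
  have "Z t0 = lin_path jv b \<phi> \<psi> t0"
    using * by (cases "Z t0") (auto simp: lin_path_def init x0_def y0_def)
  \<comment> \<open>Agreement is locally constant, so connectedness of the half-line carries it from
    t0 to every later time; the restarts need not be enumerated.\<close>
  then have "Z t = lin_path jv b \<phi> \<psi> t" if "t \<ge> t0" for t
    by (intro connected_induction_simple[of "{t0..}" t0 t "\<lambda>t. Z t = lin_path jv b \<phi> \<psi> t"]
        riccati_path_lin_path_local[OF Z t0 b jv lin nz]) (use that in auto)
  with lin nz that show ?thesis by blast
qed

lemma tendsto_ereal_MInfty:
  "filterlim f at_bot F \<Longrightarrow> ((\<lambda>x. ereal (f x)) \<longlongrightarrow> -\<infinity>) F"
  by (simp add: tendsto_MInfty filterlim_at_bot_dense)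

text \<open>At a zero of \<phi> the function \<psi> is nonzero and \<phi> / \<psi> has derivative
  exactly 1. Zeros are therefore isolated and always crossed upwards, which makes the left limit of
  the path -\<infinity> and its right limit \<infinity>.\<close>

lemma riccati_path_lin_path:
  assumes lin: "lin_sys (\<lambda>t. a + \<beta> / 4 * t) b \<phi> \<psi>" and b: "continuous_on {0..} b"
    and nz: "\<And>s. s \<ge> 0 \<Longrightarrow> \<phi> s \<noteq> 0 \<or> \<psi> s \<noteq> 0" and t0: "0 \<le> t0"
  shows "riccati_path \<beta> a b {t0..} jv (lin_path jv b \<phi> \<psi>)"
  unfolding riccati_path_def
proof
  fix t assume t: "t \<in> {t0..}"
  let ?Z = "lin_path jv b \<phi> \<psi>"
  have D: "(\<phi> has_real_derivative b t * \<phi> t + \<psi> t) (at t within {t0..})"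
    "(\<psi> has_real_derivative (a + \<beta> / 4 * t - (b t)\<^sup>2) * \<phi> t - b t * \<psi> t) (at t within {t0..})"
    using lin_sysD[OF lin, of t] t t0 by (auto intro: DERIV_subset)
  have Zfin: "?Z s \<noteq> \<infinity> \<and> ?Z s \<noteq> -\<infinity>" "real_of_ereal (?Z s) - b s = \<psi> s / \<phi> s" if "\<phi> s \<noteq> 0" for s
    using that by (auto simp: lin_path_def)
  show "?Z t \<noteq> \<infinity> \<and> ?Z t \<noteq> -\<infinity> \<and>
         (\<exists>\<delta>>0. \<forall>s\<in>{t0..}. \<bar>s - t\<bar> < \<delta> \<longrightarrow> ?Z s \<noteq> \<infinity> \<and> ?Z s \<noteq> -\<infinity>) \<and>
         ((\<lambda>s. real_of_ereal (?Z s) - b s) has_real_derivative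
             (a + \<beta> / 4 * t - (real_of_ereal (?Z t))\<^sup>2)) (at t within {t0..})
      \<or> ?Z t = jv \<and>
         (\<exists>\<delta>>0. \<forall>s\<in>{t0..}. 0 < \<bar>s - t\<bar> \<and> \<bar>s - t\<bar> < \<delta> \<longrightarrow> ?Z s \<noteq> \<infinity> \<and> ?Z s \<noteq> -\<infinity>) \<and>
         (?Z \<longlongrightarrow> \<infinity>) (at t within ({t0..} \<inter> {t<..})) \<and>
         (?Z \<longlongrightarrow> -\<infinity>) (at t within ({t0..} \<inter> {..<t}))"
  proof (cases "\<phi> t = 0")
    case False
    have "(\<phi> \<longlongrightarrow> \<phi> t) (at t within {t0..})"
      using DERIV_continuous[OF D(1)] by (simp add: continuous_within)
    then have "\<forall>\<^sub>F s in at t within {t0..}. \<phi> s \<noteq> 0"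
      using False by (rule tendsto_imp_eventually_ne)
    then obtain \<delta> where \<delta>: "\<delta> > 0" "\<And>s. s \<ge> t0 \<Longrightarrow> \<bar>s - t\<bar> < \<delta> \<Longrightarrow> \<phi> s \<noteq> 0"
      using False unfolding eventually_at by (metis atLeast_iff dist_real_def)
    have "((\<lambda>s. \<psi> s / \<phi> s) has_real_derivative a + \<beta> / 4 * t - (b t + \<psi> t / \<phi> t)\<^sup>2) (at t within {t0..})"
      by (rule derivative_eq_intros D False refl)+
         (use False in \<open>simp add: field_simps power2_eq_square\<close>)
    then have "((\<lambda>s. real_of_ereal (?Z s) - b s) has_real_derivative
        a + \<beta> / 4 * t - (b t + \<psi> t / \<phi> t)\<^sup>2) (at t within {t0..})"
      by (rule has_field_derivative_transform_within[OF _ \<delta>(1) t])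
         (use \<delta>(2) Zfin(2) in \<open>auto simp: dist_real_def\<close>)
    moreover have "b t + \<psi> t / \<phi> t = real_of_ereal (?Z t)" using False by (simp add: lin_path_def)
    moreover have "\<exists>\<delta>>0. \<forall>s\<in>{t0..}. \<bar>s - t\<bar> < \<delta> \<longrightarrow> ?Z s \<noteq> \<infinity> \<and> ?Z s \<noteq> -\<infinity>"
      using \<delta> Zfin(1) by (intro exI[of _ \<delta>]) auto
    ultimately show ?thesis using Zfin(1)[OF False] by (intro disjI1 conjI) simp_all
  next
    case True
    then have \<psi>0: "\<psi> t \<noteq> 0" using nz[of t] t t0 by auto
    define V where "V s = \<phi> s / \<psi> s" for s
    have Vt: "V t = 0" by (simp add: V_def True)
    have dV: "(V has_real_derivative 1) (at t within {t0..})"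
      unfolding V_def[abs_def]
      by (rule derivative_eq_intros D \<psi>0 refl)+ (use True \<psi>0 in \<open>simp add: field_simps power2_eq_square\<close>)
    have V0: "(V \<longlongrightarrow> 0) (at t within {t0..})"
      using DERIV_continuous[OF dV] Vt by (simp add: continuous_within)
    obtain d1 where d1: "d1 > 0" "\<And>h. h > 0 \<Longrightarrow> t + h \<in> {t0..} \<Longrightarrow> h < d1 \<Longrightarrow> 0 < V (t + h)"
      using has_real_derivative_pos_inc_right[OF dV] Vt by auto
    obtain d2 where d2: "d2 > 0" "\<And>h. h > 0 \<Longrightarrow> t - h \<in> {t0..} \<Longrightarrow> h < d2 \<Longrightarrow> V (t - h) < 0"
      using has_real_derivative_pos_inc_left[OF dV] Vt by auto
    have right: "V s > 0" if "s > t" "s - t < d1" for s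
      using d1(2)[of "s - t"] that t by auto
    have left: "V s < 0" if "s < t" "t - s < d2" "s \<ge> t0" for s
      using d2(2)[of "t - s"] that by auto
    have evr: "\<forall>\<^sub>F s in at t within ({t0..} \<inter> {t<..}). V s > 0"
      unfolding eventually_at using d1(1) right by (intro exI[of _ d1]) (auto simp: dist_real_def)
    have evl: "\<forall>\<^sub>F s in at t within ({t0..} \<inter> {..<t}). V s < 0"
      unfolding eventually_at using d2(1) left by (intro exI[of _ d2]) (auto simp: dist_real_def)
    have bt: "(b \<longlongrightarrow> b t) (at t within S)" if "S \<subseteq> {t0..}" for S
    proof -
      have "(b \<longlongrightarrow> b t) (at t within {0..})" using b t t0 by (auto simp: continuous_on_def)
      then show ?thesis by (rule tendsto_within_subset) (use that t0 in auto)
    qed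
    have eqZ: "?Z s = ereal (b s + inverse (V s))" if "V s \<noteq> 0" for s
      using that by (auto simp: lin_path_def V_def)
    have "filterlim (\<lambda>s. b s + inverse (V s)) at_top (at t within ({t0..} \<inter> {t<..}))"
      by (intro filterlim_tendsto_add_at_top[OF bt] filterlim_inverse_at_top evr tendsto_within_subset[OF V0]) auto
    then have "((\<lambda>s. ereal (b s + inverse (V s))) \<longlongrightarrow> \<infinity>) (at t within ({t0..} \<inter> {t<..}))"
      by (simp add: tendsto_PInfty_eq_at_top)
    then have R: "(?Z \<longlongrightarrow> \<infinity>) (at t within ({t0..} \<inter> {t<..}))"
      by (rule Lim_transform_eventually) (use evr in \<open>eventually_elim, simp add: eqZ\<close>)
    have "((\<lambda>s. - V s) \<longlongrightarrow> 0) (at t within ({t0..} \<inter> {..<t}))"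
      using tendsto_minus[OF tendsto_within_subset[OF V0]] by simp
    then have "filterlim (\<lambda>s. - b s + inverse (- V s)) at_top (at t within ({t0..} \<inter> {..<t}))"
      using evl by (intro filterlim_tendsto_add_at_top[OF tendsto_minus[OF bt]] filterlim_inverse_at_top) auto
    then have "filterlim (\<lambda>s. b s + inverse (V s)) at_bot (at t within ({t0..} \<inter> {..<t}))"
      by (simp add: filterlim_uminus_at_bot)
    then have "((\<lambda>s. ereal (b s + inverse (V s))) \<longlongrightarrow> -\<infinity>) (at t within ({t0..} \<inter> {..<t}))"
      by (rule tendsto_ereal_MInfty)
    then have L: "(?Z \<longlongrightarrow> -\<infinity>) (at t within ({t0..} \<inter> {..<t}))"
      by (rule Lim_transform_eventually) (use evl in \<open>eventually_elim, simp add: eqZ\<close>)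
    have "?Z s \<noteq> \<infinity> \<and> ?Z s \<noteq> -\<infinity>" if "s \<in> {t0..}" "0 < \<bar>s - t\<bar> \<and> \<bar>s - t\<bar> < min d1 d2" for s
    proof -
      have "V s \<noteq> 0" using right[of s] left[of s] that by (cases "s < t") auto
      then show ?thesis by (simp add: eqZ)
    qed
    moreover have "min d1 d2 > 0" using d1 d2 by simp
    moreover have "?Z t = jv" using True by (simp add: lin_path_def)
    ultimately show ?thesis using R L by blast
  qed
qed

section \<open>Asymptotics under a growing potential\<close>

text \<open>As long as v is nonpositive it climbs with at least unit speed, so it must become
  positive. It cannot come back: at a nonpositive minimum after t2 the derivative would be positive,
  and v would be smaller just before.\<close>

lemma eventually_pos_of_deriv_ge_1:
  fixes v :: "real \<Rightarrow> real"
  assumes der: "\<And>t. t \<ge> t1 \<Longrightarrow> (v has_real_derivative v' t) (at t)"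
    and ge: "\<And>t. t \<ge> t1 \<Longrightarrow> v t \<le> 0 \<Longrightarrow> v' t \<ge> 1"
  shows "\<exists>t2. \<forall>t\<ge>t2. v t > 0"
proof -
  have cont: "continuous_on {x..y} v" if "x \<ge> t1" for x y
    by (rule DERIV_continuous_on, rule has_field_derivative_at_within, rule der) (use that in auto)
  have "\<exists>t2\<ge>t1. v t2 > 0"
  proof (rule ccontr)
    assume "\<not> ?thesis"
    then have neg: "v t \<le> 0" if "t \<ge> t1" for t using that by force
    define t where "t = t1 + \<bar>v t1\<bar> + 1"
    have "v t1 - t1 \<le> v t - t"
    proof (rule DERIV_nonneg_imp_nondecreasing[where f = "\<lambda>t. v t - t"])
      show "\<exists>y. ((\<lambda>t. v t - t) has_real_derivative y) (at s) \<and> 0 \<le> y" if "t1 \<le> s" "s \<le> t" for s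
        using ge[OF that(1) neg[OF that(1)]] that
        by (intro exI[of _ "v' s - 1"]) (auto intro!: derivative_eq_intros der)
    qed (simp add: t_def)
    then show False using neg[of t] by (simp add: t_def)
  qed
  then obtain t2 where t2: "t2 \<ge> t1" "v t2 > 0" by blast
  have "v t > 0" if "t \<ge> t2" for t
  proof (rule ccontr)
    assume t: "\<not> v t > 0"
    have "\<exists>m\<in>{t2..t}. \<forall>s\<in>{t2..t}. v m \<le> v s"
      by (rule continuous_attains_inf) (use cont t2 that in auto)
    then obtain m where m: "m \<in> {t2..t}" "\<And>s. s \<in> {t2..t} \<Longrightarrow> v m \<le> v s" by blast
    have "v m \<le> 0" using m(2)[of t] t that by auto
    with t2 m have "t2 < m" "v' m \<ge> 1" using ge[of m] by (auto simp: less_le)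
    then obtain e where e: "e > 0" "\<And>h. h > 0 \<Longrightarrow> h < e \<Longrightarrow> v (m - h) < v m"
      using DERIV_pos_inc_left[OF der[of m]] t2 by auto
    define h where "h = min (e / 2) (m - t2)"
    have "h > 0" "h < e" "m - h \<in> {t2..t}" using e(1) \<open>t2 < m\<close> m(1) by (auto simp: h_def min_def)
    then show False using e(2)[of h] m(2)[of "m - h"] by simp
  qed
  then show ?thesis by blast
qed

text \<open>The maximum over [t1, t] is nonnegative. If v t were negative, the maximum would be
  attained before t, where the positive derivative yields larger values just after it.\<close>

lemma nonneg_of_deriv_ge_1:
  fixes v :: "real \<Rightarrow> real"
  assumes der: "\<And>t. t \<ge> t1 \<Longrightarrow> (v has_real_derivative v' t) (at t)"
    and ge: "\<And>t. t \<ge> t1 \<Longrightarrow> v t \<ge> 0 \<Longrightarrow> v' t \<ge> 1"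
    and "v t1 \<ge> 0" "t \<ge> t1"
  shows "v t \<ge> 0"
proof (rule ccontr)
  assume t: "\<not> v t \<ge> 0"
  have "continuous_on {t1..t} v"
    by (rule DERIV_continuous_on, rule has_field_derivative_at_within, rule der) auto
  then obtain m where m: "m \<in> {t1..t}" "\<And>s. s \<in> {t1..t} \<Longrightarrow> v s \<le> v m"
    using continuous_attains_sup[of "{t1..t}" v] assms(4) by auto
  have "v m \<ge> 0" using m(2)[of t1] assms by auto
  with t m have "m < t" "v' m \<ge> 1" using ge[of m] by (auto simp: less_le)
  then obtain e where e: "e > 0" "\<And>h. h > 0 \<Longrightarrow> h < e \<Longrightarrow> v m < v (m + h)"
    using DERIV_pos_inc_right[OF der[of m]] m by auto
  define h where "h = min (e / 2) (t - m)"
  have "h > 0" "h < e" "m + h \<in> {t1..t}" using e(1) \<open>m < t\<close> m(1) by (auto simp: h_def min_def)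
  then show False using e(2)[of h] m(2)[of "m + h"] by simp
qed

text \<open>The curves \<kappa> sqrt t and -\<kappa> sqrt t are barriers for the ratio w = \<psi> /
  \<phi>, whose drift is q - (w + d)^2. In \<open>drift\<close>, the summand \<kappa> pays for the
  slope of the barrier, at most \<kappa> for t \<ge> 1, and 1 remains as net speed. The gap between
  \<epsilon> and \<kappa> ensures that a ratio beyond a barrier still forces d + w to
  infinity.\<close>

locale growing_potential =
  fixes q d :: "real \<Rightarrow> real" and \<kappa> \<epsilon> T :: real
  assumes cont_q: "continuous_on {0..} q" and cont_d: "continuous_on {0..} d"
    and T: "T \<ge> 1" and \<epsilon>: "\<epsilon> < \<kappa>" and \<kappa>: "\<kappa> > 0"
    and d_le: "\<And>t. t \<ge> T \<Longrightarrow> \<bar>d t\<bar> \<le> \<epsilon> * sqrt t"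
    and drift: "\<And>t w. t \<ge> T \<Longrightarrow> \<bar>w\<bar> \<le> \<kappa> * sqrt t \<Longrightarrow> 1 + \<kappa> \<le> q t - (w + d t)\<^sup>2"
begin

lemma potential_ge_1: "t \<ge> T \<Longrightarrow> 1 \<le> q t - (d t)\<^sup>2"
  using drift[of t 0] T \<kappa> by simp

lemma prod_deriv:
  assumes "lin_sys q d \<phi> \<psi>" "t \<ge> T"
  shows "((\<lambda>t. \<phi> t * \<psi> t) has_real_derivative (\<psi> t)\<^sup>2 + (q t - (d t)\<^sup>2) * (\<phi> t)\<^sup>2) (at t)"
    and "(\<psi> t)\<^sup>2 + (q t - (d t)\<^sup>2) * (\<phi> t)\<^sup>2 \<ge> (\<phi> t)\<^sup>2 + (\<psi> t)\<^sup>2"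
proof -
  have "t > 0" using assms(2) T by simp
  note D = lin_sys_derivs_at[OF assms(1) this]
  show "((\<lambda>t. \<phi> t * \<psi> t) has_real_derivative (\<psi> t)\<^sup>2 + (q t - (d t)\<^sup>2) * (\<phi> t)\<^sup>2) (at t)"
    by (rule derivative_eq_intros D refl)+ (simp add: algebra_simps power2_eq_square)
  show "(\<psi> t)\<^sup>2 + (q t - (d t)\<^sup>2) * (\<phi> t)\<^sup>2 \<ge> (\<phi> t)\<^sup>2 + (\<psi> t)\<^sup>2"
    using mult_right_mono[OF potential_ge_1[OF assms(2)], of "(\<phi> t)\<^sup>2"] by simp
qed

lemma prod_mono:
  assumes "lin_sys q d \<phi> \<psi>" "T \<le> s" "s \<le> t"
  shows "\<phi> s * \<psi> s \<le> \<phi> t * \<psi> t"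
proof (rule DERIV_nonneg_imp_nondecreasing[where f = "\<lambda>t. \<phi> t * \<psi> t"])
  fix x assume "s \<le> x" "x \<le> t"
  then have "x \<ge> T" using assms by simp
  with prod_deriv[OF assms(1) this]
  show "\<exists>y. ((\<lambda>t. \<phi> t * \<psi> t) has_real_derivative y) (at x) \<and> 0 \<le> y"
    by (meson add_nonneg_nonneg order_trans zero_le_power2)
qed (fact assms(3))

lemma prod_strict_mono:
  assumes "lin_sys q d \<phi> \<psi>" "\<And>t. t \<ge> 0 \<Longrightarrow> \<phi> t \<noteq> 0 \<or> \<psi> t \<noteq> 0" "T \<le> s" "s < t"
  shows "\<phi> s * \<psi> s < \<phi> t * \<psi> t"
proof (rule DERIV_pos_imp_increasing[where f = "\<lambda>t. \<phi> t * \<psi> t"])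
  fix x assume "s \<le> x" "x \<le> t"
  then have x: "x \<ge> T" using assms by simp
  then have "(\<phi> x)\<^sup>2 + (\<psi> x)\<^sup>2 > 0" using assms(2)[of x] T sum_power2_gt_zero_iff by force
  with prod_deriv[OF assms(1) x]
  show "\<exists>y. ((\<lambda>t. \<phi> t * \<psi> t) has_real_derivative y) (at x) \<and> 0 < y"
    by (meson less_le_trans)
qed (fact assms(4))

lemma ratio_deriv:
  assumes "lin_sys q d \<phi> \<psi>" "t > 0" "\<phi> t \<noteq> 0"
  shows "((\<lambda>t. \<psi> t / \<phi> t) has_real_derivative q t - (\<psi> t / \<phi> t + d t)\<^sup>2) (at t)"
proof -
  note D = lin_sys_derivs_at[OF assms(1,2)]
  show ?thesis
    by (rule derivative_eq_intros D assms(3) refl)+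
       (use assms(3) in \<open>simp add: field_simps power2_eq_square\<close>)
qed

lemma barrier_deriv:
  assumes "t \<ge> T"
  obtains r where "((\<lambda>t. \<kappa> * sqrt t) has_real_derivative r) (at t)" "0 \<le> r" "r \<le> \<kappa>"
proof
  have t: "t \<ge> 1" using assms T by simp
  then show "((\<lambda>t. \<kappa> * sqrt t) has_real_derivative \<kappa> * (inverse (sqrt t) / 2)) (at t)"
    by (auto intro!: derivative_eq_intros)
  have "inverse (sqrt t) \<le> 1" using t by (simp add: inverse_le_1_iff)
  then have "\<kappa> * (inverse (sqrt t) / 2) \<le> \<kappa> * 1" using \<kappa> by (intro mult_left_mono) auto
  then show "\<kappa> * (inverse (sqrt t) / 2) \<le> \<kappa>" by simp
  show "0 \<le> \<kappa> * (inverse (sqrt t) / 2)" using \<kappa> t by simp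
qed

lemma sqrt_barrier_at_top: "filterlim (\<lambda>t. (\<kappa> - \<epsilon>) * sqrt t) at_top at_top"
  using \<epsilon> by (intro filterlim_tendsto_pos_mult_at_top[OF tendsto_const _ sqrt_at_top]) auto

text \<open>Once positive, the product stays so, and hence the ratio stays positive. Below the upper
  barrier it then lies in the band where \<open>drift\<close> applies, so it overtakes the barrier
  for good.\<close>

lemma tendsto_PInfty_if_prod_pos:
  assumes lin: "lin_sys q d \<phi> \<psi>" and t1: "t1 \<ge> T" "\<phi> t1 * \<psi> t1 > 0"
  shows "(lin_path jv d \<phi> \<psi> \<longlongrightarrow> \<infinity>) at_top"
proof -
  have pos: "\<phi> t * \<psi> t > 0" if "t \<ge> t1" for t
    using prod_mono[OF lin t1(1) that] t1(2) by simp
  then have \<phi>: "\<phi> t \<noteq> 0" "\<psi> t / \<phi> t > 0" if "t \<ge> t1" for t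
    using that by (force, metis zero_less_divide_iff zero_less_mult_iff)
  have "\<exists>r. ((\<lambda>t. \<kappa> * sqrt t) has_real_derivative r) (at t) \<and> 0 \<le> r \<and> r \<le> \<kappa>" if "t \<ge> T" for t
    using barrier_deriv[OF that] by metis
  then obtain r where r: "\<And>t. t \<ge> T \<Longrightarrow> ((\<lambda>t. \<kappa> * sqrt t) has_real_derivative r t) (at t)"
      "\<And>t. t \<ge> T \<Longrightarrow> r t \<le> \<kappa>" by metis
  have "\<exists>t2. \<forall>t\<ge>t2. \<psi> t / \<phi> t - \<kappa> * sqrt t > 0"
  proof (rule eventually_pos_of_deriv_ge_1)
    fix t assume t: "t \<ge> t1"
    show "((\<lambda>t. \<psi> t / \<phi> t - \<kappa> * sqrt t) has_real_derivative q t - (\<psi> t / \<phi> t + d t)\<^sup>2 - r t) (at t)"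
      using t t1 T by (intro DERIV_diff ratio_deriv lin r(1) \<phi>) auto
    assume "\<psi> t / \<phi> t - \<kappa> * sqrt t \<le> 0"
    then have "\<bar>\<psi> t / \<phi> t\<bar> \<le> \<kappa> * sqrt t" using \<phi>(2)[OF t] by simp
    then show "q t - (\<psi> t / \<phi> t + d t)\<^sup>2 - r t \<ge> 1"
      using drift[of t] r(2)[of t] t t1 by fastforce
  qed
  then obtain t2 where t2: "\<And>t. t \<ge> t2 \<Longrightarrow> \<psi> t / \<phi> t > \<kappa> * sqrt t" by auto
  have "filterlim (\<lambda>t. d t + \<psi> t / \<phi> t) at_top at_top"
  proof (rule filterlim_at_top_mono[OF sqrt_barrier_at_top])
    have "(\<kappa> - \<epsilon>) * sqrt t \<le> d t + \<psi> t / \<phi> t" if "t \<ge> max T t2" for t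
      using t2[of t] d_le[of t] that by (simp add: algebra_simps)
    then show "\<forall>\<^sub>F t in at_top. (\<kappa> - \<epsilon>) * sqrt t \<le> d t + \<psi> t / \<phi> t"
      unfolding eventually_at_top_linorder by blast
  qed
  then have "((\<lambda>t. ereal (d t + \<psi> t / \<phi> t)) \<longlongrightarrow> \<infinity>) at_top"
    by (simp add: tendsto_PInfty_eq_at_top)
  moreover have "\<forall>\<^sub>F t in at_top. ereal (d t + \<psi> t / \<phi> t) = lin_path jv d \<phi> \<psi> t"
    using \<phi>(1) unfolding eventually_at_top_linorder by (intro exI[of _ t1]) (auto simp: lin_path_def)
  ultimately show ?thesis by (rule Lim_transform_eventually)
qed

text \<open>The ratio is negative from T on. If it ever reached the lower barrier, the drift would
  keep it in the band and raise it at unit speed, making it positive in finite time. So it lies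
  below the lower barrier throughout.\<close>

lemma tendsto_MInfty_if_prod_nonpos:
  assumes lin: "lin_sys q d \<phi> \<psi>" and nz: "\<And>t. t \<ge> 0 \<Longrightarrow> \<phi> t \<noteq> 0 \<or> \<psi> t \<noteq> 0"
    and nonpos: "\<And>t. t \<ge> T \<Longrightarrow> \<phi> t * \<psi> t \<le> 0"
  shows "(lin_path jv d \<phi> \<psi> \<longlongrightarrow> -\<infinity>) at_top"
proof -
  \<comment> \<open>Strict monotonicity excludes the value 0 at t, since the product would be
    positive at t + 1.\<close>
  have neg: "\<phi> t * \<psi> t < 0" if "t \<ge> T" for t
    using prod_strict_mono[OF lin nz that, of "t + 1"] nonpos[of "t + 1"] that by simp
  then have \<phi>: "\<phi> t \<noteq> 0" "\<psi> t / \<phi> t < 0" if "t \<ge> T" for t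
    using that by (force, metis divide_less_0_iff mult_less_0_iff)
  have "\<exists>r. ((\<lambda>t. \<kappa> * sqrt t) has_real_derivative r) (at t) \<and> 0 \<le> r \<and> r \<le> \<kappa>" if "t \<ge> T" for t
    using barrier_deriv[OF that] by metis
  then obtain r where r: "\<And>t. t \<ge> T \<Longrightarrow> ((\<lambda>t. \<kappa> * sqrt t) has_real_derivative r t) (at t)"
      "\<And>t. t \<ge> T \<Longrightarrow> 0 \<le> r t" by metis
  have below: "\<psi> t / \<phi> t < - (\<kappa> * sqrt t)" if t: "t \<ge> T" for t
  proof (rule ccontr)
    assume above: "\<not> \<psi> t / \<phi> t < - (\<kappa> * sqrt t)"
    have ge1: "q s - (\<psi> s / \<phi> s + d s)\<^sup>2 \<ge> 1" if "s \<ge> t" "\<psi> s / \<phi> s + \<kappa> * sqrt s \<ge> 0" for s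
    proof -
      have "\<bar>\<psi> s / \<phi> s\<bar> \<le> \<kappa> * sqrt s" using that t \<phi>(2)[of s] by (simp add: abs_le_iff)
      then show ?thesis using drift[of s] that t \<kappa> by fastforce
    qed
    have nonneg: "\<psi> s / \<phi> s + \<kappa> * sqrt s \<ge> 0" if "s \<ge> t" for s
    proof (rule nonneg_of_deriv_ge_1[OF _ _ _ that])
      fix s assume s: "s \<ge> t"
      show "((\<lambda>t. \<psi> t / \<phi> t + \<kappa> * sqrt t) has_real_derivative q s - (\<psi> s / \<phi> s + d s)\<^sup>2 + r s) (at s)"
        using t s T by (intro DERIV_add ratio_deriv lin r(1) \<phi>) auto
      assume "0 \<le> \<psi> s / \<phi> s + \<kappa> * sqrt s"
      then show "q s - (\<psi> s / \<phi> s + d s)\<^sup>2 + r s \<ge> 1"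
        using ge1[OF s] r(2)[of s] s t by simp
    qed (use above in simp)
    have "\<exists>t2. \<forall>s\<ge>t2. \<psi> s / \<phi> s > 0"
      by (rule eventually_pos_of_deriv_ge_1[of t _ "\<lambda>s. q s - (\<psi> s / \<phi> s + d s)\<^sup>2"])
         (use t T \<phi> ge1 nonneg in \<open>auto intro!: ratio_deriv lin\<close>)
    then obtain t2 where "\<And>s. s \<ge> t2 \<Longrightarrow> \<psi> s / \<phi> s > 0" by blast
    from this[of "max t2 T"] \<phi>(2)[of "max t2 T"] show False by simp
  qed
  have "filterlim (\<lambda>t. - (d t + \<psi> t / \<phi> t)) at_top at_top"
  proof (rule filterlim_at_top_mono[OF sqrt_barrier_at_top])
    have "(\<kappa> - \<epsilon>) * sqrt t \<le> - (d t + \<psi> t / \<phi> t)" if "t \<ge> T" for t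
      using below[of t] d_le[of t] that by (simp add: algebra_simps)
    then show "\<forall>\<^sub>F t in at_top. (\<kappa> - \<epsilon>) * sqrt t \<le> - (d t + \<psi> t / \<phi> t)"
      unfolding eventually_at_top_linorder by blast
  qed
  then have "filterlim (\<lambda>t. d t + \<psi> t / \<phi> t) at_bot at_top"
    by (subst filterlim_uminus_at_bot)
  then have "((\<lambda>t. ereal (d t + \<psi> t / \<phi> t)) \<longlongrightarrow> -\<infinity>) at_top"
    by (rule tendsto_ereal_MInfty)
  moreover have "\<forall>\<^sub>F t in at_top. ereal (d t + \<psi> t / \<phi> t) = lin_path jv d \<phi> \<psi> t"
    using \<phi>(1) unfolding eventually_at_top_linorder by (intro exI[of _ T]) (auto simp: lin_path_def)
  ultimately show ?thesis by (rule Lim_transform_eventually)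
qed

text \<open>The Wronskian is bounded by half the derivative of \<open>\<phi> \<psi> + \<phi>' \<psi>'\<close>, which would
  grow linearly were the Wronskian nonzero.\<close>

lemma wronskian_eq_0_if_prod_nonpos:
  assumes lin: "lin_sys q d \<phi> \<psi>" "lin_sys q d \<phi>' \<psi>'"
    and nonpos: "\<And>t. t \<ge> T \<Longrightarrow> \<phi> t * \<psi> t \<le> 0" "\<And>t. t \<ge> T \<Longrightarrow> \<phi>' t * \<psi>' t \<le> 0"
  shows "\<phi> 0 * \<psi>' 0 - \<phi>' 0 * \<psi> 0 = 0"
proof (rule ccontr)
  define W where "W = \<phi> 0 * \<psi>' 0 - \<phi>' 0 * \<psi> 0"
  assume "\<phi> 0 * \<psi>' 0 - \<phi>' 0 * \<psi> 0 \<noteq> 0"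
  then have W: "\<bar>W\<bar> > 0" by (simp add: W_def)
  define P where "P t = \<phi> t * \<psi> t + \<phi>' t * \<psi>' t" for t
  \<comment> \<open>Late enough for growth at rate |W| to lift P from its value at T above
    0.\<close>
  define t where "t = T + (1 + \<bar>P T\<bar>) / \<bar>W\<bar>"
  have "P T - \<bar>W\<bar> * T \<le> P t - \<bar>W\<bar> * t"
  proof (rule DERIV_nonneg_imp_nondecreasing[where f = "\<lambda>t. P t - \<bar>W\<bar> * t"])
    fix s assume "T \<le> s" "s \<le> t"
    note 1 = prod_deriv[OF lin(1) \<open>T \<le> s\<close>] and 2 = prod_deriv[OF lin(2) \<open>T \<le> s\<close>]
    have W_eq: "W = \<phi> s * \<psi>' s - \<phi>' s * \<psi> s"
      using lin_sys_wronskian[OF lin, of s] \<open>T \<le> s\<close> T by (simp add: W_def)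
    \<comment> \<open>Subtracting 2 W, respectively -2 W, from the sum of the four squares leaves a
      sum of two squares.\<close>
    have "0 \<le> (\<phi> s - \<psi>' s)\<^sup>2 + (\<phi>' s + \<psi> s)\<^sup>2" "0 \<le> (\<phi> s + \<psi>' s)\<^sup>2 + (\<phi>' s - \<psi> s)\<^sup>2" by simp_all
    then have "2 * \<bar>W\<bar> \<le> (\<phi> s)\<^sup>2 + (\<psi> s)\<^sup>2 + ((\<phi>' s)\<^sup>2 + (\<psi>' s)\<^sup>2)"
      unfolding W_eq by (simp add: power2_diff power2_sum abs_if)
    then have "\<bar>W\<bar> \<le> (\<psi> s)\<^sup>2 + (q s - (d s)\<^sup>2) * (\<phi> s)\<^sup>2 + ((\<psi>' s)\<^sup>2 + (q s - (d s)\<^sup>2) * (\<phi>' s)\<^sup>2)"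
      using 1(2) 2(2) W by linarith
    moreover have "((\<lambda>t. P t - \<bar>W\<bar> * t) has_real_derivative (\<psi> s)\<^sup>2 + (q s - (d s)\<^sup>2) * (\<phi> s)\<^sup>2
        + ((\<psi>' s)\<^sup>2 + (q s - (d s)\<^sup>2) * (\<phi>' s)\<^sup>2) - \<bar>W\<bar>) (at s)"
      unfolding P_def by (rule derivative_eq_intros 1(1) 2(1) refl)+ simp
    ultimately show "\<exists>y. ((\<lambda>t. P t - \<bar>W\<bar> * t) has_real_derivative y) (at s) \<and> 0 \<le> y"
      by (intro exI conjI) (assumption, linarith)
  qed (use W in \<open>simp add: t_def\<close>)
  moreover have "\<bar>W\<bar> * t = \<bar>W\<bar> * T + (1 + \<bar>P T\<bar>)" using W by (simp add: t_def field_simps)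
  moreover have "P t \<le> 0" using nonpos[of t] W by (auto simp: P_def t_def intro: add_nonpos_nonpos)
  ultimately show False by linarith
qed

text \<open>The directions whose product is nonpositive at time \<open>T + n\<close> form a decreasing sequence of
  nonempty compact subsets of the circle.\<close>

lemma prod_nonpos_exists:
  obtains \<phi> \<psi> where "lin_sys q d \<phi> \<psi>" "\<And>t. t \<ge> 0 \<Longrightarrow> \<phi> t \<noteq> 0 \<or> \<psi> t \<noteq> 0"
    "\<And>t. t \<ge> T \<Longrightarrow> \<phi> t * \<psi> t \<le> 0"
proof -
  obtain \<phi>1 \<psi>1 \<phi>2 \<psi>2 where 1: "lin_sys q d \<phi>1 \<psi>1" and 2: "lin_sys q d \<phi>2 \<psi>2"
    and W: "\<And>t. t \<ge> 0 \<Longrightarrow> \<phi>1 t * \<psi>2 t - \<phi>2 t * \<psi>1 t = 1"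
    using lin_sys_fundamental[OF cont_q cont_d] by metis
  define \<phi> where "\<phi> v t = fst v * \<phi>1 t + snd v * \<phi>2 t" for v :: "real \<times> real" and t
  define \<psi> where "\<psi> v t = fst v * \<psi>1 t + snd v * \<psi>2 t" for v :: "real \<times> real" and t
  have lin: "lin_sys q d (\<phi> v) (\<psi> v)" for v
    using lin_sys_lincomb[OF 1 2, of "fst v" "snd v"] by (simp add: \<phi>_def[abs_def] \<psi>_def[abs_def])
  have nz: "\<phi> v t \<noteq> 0 \<or> \<psi> v t \<noteq> 0" if "v \<noteq> 0" "t \<ge> 0" for v t
  proof (rule ccontr)
    assume "\<not> ?thesis"
    then have 0: "\<phi> v t = 0" "\<psi> v t = 0" by auto
    have "fst v * (\<phi>1 t * \<psi>2 t - \<phi>2 t * \<psi>1 t) = \<phi> v t * \<psi>2 t - \<psi> v t * \<phi>2 t"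
      "snd v * (\<phi>1 t * \<psi>2 t - \<phi>2 t * \<psi>1 t) = \<psi> v t * \<phi>1 t - \<phi> v t * \<psi>1 t"
      by (simp_all add: \<phi>_def \<psi>_def algebra_simps)
    then have "fst v = 0" "snd v = 0" using W[OF that(2)] 0 by simp_all
    then show False using that(1) by (simp add: prod_eq_iff)
  qed
  define C where "C n = sphere 0 1 \<inter> {v. \<phi> v (T + real n) * \<psi> v (T + real n) \<le> 0}" for n :: nat
  have "\<Inter> (range C) \<noteq> {}"
  proof (rule compact_nest)
    fix n
    show "compact (C n)"
      unfolding C_def \<phi>_def \<psi>_def
      by (intro compact_Int_closed closed_Collect_le continuous_intros compact_sphere)
    define t where "t = T + real n"
    have t: "t \<ge> 0" using T by (simp add: t_def)
    \<comment> \<open>The direction whose \<phi> vanishes at t, so that its product there is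
      0.\<close>
    define v where "v = (\<phi>2 t, - \<phi>1 t)"
    have "v \<noteq> 0" using W[OF t] by (auto simp: v_def zero_prod_def)
    then have "norm (v /\<^sub>R norm v) = 1" by simp
    moreover have "\<phi> (v /\<^sub>R norm v) t = 0" by (simp add: \<phi>_def v_def)
    ultimately have "v /\<^sub>R norm v \<in> C n" by (simp add: C_def flip: t_def)
    then show "C n \<noteq> {}" by blast
  next
    fix m n :: nat assume "m \<le> n"
    show "C n \<subseteq> C m"
    proof
      fix v assume "v \<in> C n"
      moreover have "\<phi> v (T + real m) * \<psi> v (T + real m) \<le> \<phi> v (T + real n) * \<psi> v (T + real n)"
        using \<open>m \<le> n\<close> by (intro prod_mono lin) auto
      ultimately show "v \<in> C m" unfolding C_def by simp
    qed
  qed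
  then obtain v where v: "\<And>n. v \<in> C n" by blast
  show ?thesis
  proof (rule that[of "\<phi> v" "\<psi> v"])
    show "lin_sys q d (\<phi> v) (\<psi> v)" by (fact lin)
    show "\<phi> v t \<noteq> 0 \<or> \<psi> v t \<noteq> 0" if "t \<ge> 0" for t
      using nz[OF _ that, of v] v[of 0] by (force simp: C_def)
    fix t assume "t \<ge> T"
    obtain n :: nat where "t - T \<le> real n" using real_arch_simple by blast
    then have "t \<le> T + real n" by simp
    with prod_mono[OF lin \<open>t \<ge> T\<close>, of "T + real n" v] v[of n] show "\<phi> v t * \<psi> v t \<le> 0"
      by (simp add: C_def)
  qed
qed

end

section \<open>Moving averages and pathwise limits\<close>

definition subsqrt_osc :: "(real \<Rightarrow> real) \<Rightarrow> bool" where
  "subsqrt_osc b \<longleftrightarrow> (\<forall>\<epsilon>>0. \<exists>T. \<forall>t\<ge>T. \<forall>s\<in>{t..t+1}. \<bar>b s - b t\<bar> \<le> \<epsilon> * sqrt t)"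

text \<open>The integral of b over [t, t + 1]. By the mean value theorem it is a value of b in that
  window, and its derivative is the increment across the window. Bounding the oscillation over unit
  windows thus controls both b - g and g'.\<close>

lemma moving_average_exists:
  assumes b: "continuous_on {0..} b"
  obtains g :: "real \<Rightarrow> real"
  where "\<And>t. t \<ge> 0 \<Longrightarrow> (g has_real_derivative b (t + 1) - b t) (at t within {0..})"
    and "\<And>t. t \<ge> 0 \<Longrightarrow> \<exists>s\<in>{t..t+1}. g t = b s"
proof -
  define G where "G t = integral {0..t} b" for t
  have dG: "(G has_real_derivative b t) (at t within {0..})" if "t \<ge> 0" for t
    unfolding G_def[abs_def] has_real_derivative_iff_has_vector_derivative
    using integral_has_vector_derivative_Ici[OF b that] .
  define g where "g t = G (t + 1) - G t" for t
  show ?thesis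
  proof (rule that)
    fix t :: real assume t: "t \<ge> 0"
    have "(G has_real_derivative b (t + 1)) (at (t + 1))"
      using dG[of "t + 1"] at_within_Ici_interior[of 0 "t + 1"] t by auto
    then have "((\<lambda>t. G (t + 1)) has_real_derivative b (t + 1)) (at t within {0..})"
      by (rule has_field_derivative_at_within[OF DERIV_shift[THEN iffD1]])
    then show "(g has_real_derivative b (t + 1) - b t) (at t within {0..})"
      unfolding g_def[abs_def] by (intro DERIV_diff dG t)
    have "continuous_on {0..} G" by (rule DERIV_continuous_on[OF dG]) simp
    then have "continuous_on {t..t+1} G" by (rule continuous_on_subset) (use t in auto)
    moreover have "(G has_derivative (*) (b s)) (at s)" if "t < s" "s < t + 1" for s
      using dG[of s] t that by (simp add: at_within_Ici_interior has_field_derivative_def)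
    ultimately obtain s where "t < s" "s < t + 1" "G (t + 1) - G t = b s * (t + 1 - t)"
      using mvt[of t "t + 1" G "\<lambda>s. (*) (b s)"] by auto
    then show "\<exists>s\<in>{t..t+1}. g t = b s" by (intro bexI[of _ s]) (auto simp: g_def)
  qed
qed

text \<open>Subtracting from \<open>b\<close> a differentiable function \<open>g\<close> moves \<open>g'\<close> into the potential. With the
  moving average \<open>g\<close> of \<open>b\<close>, both \<open>b - g\<close> and \<open>g'\<close> are \<open>o(\<surd>t)\<close>.\<close>

lemma lin_sys_shift:
  assumes lin: "lin_sys c b \<phi> \<psi>"
    and g: "\<And>t. t \<ge> 0 \<Longrightarrow> (g has_real_derivative g' t) (at t within {0..})"
  shows "lin_sys (\<lambda>t. c t + g' t) (\<lambda>t. b t - g t) \<phi> (\<lambda>t. \<psi> t + g t * \<phi> t)"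
  unfolding lin_sys_def
proof (intro allI impI)
  fix t :: real assume t: "t \<ge> 0"
  note D = lin_sysD[OF lin t] g[OF t]
  show "(\<phi> has_real_derivative (b t - g t) * \<phi> t + (\<psi> t + g t * \<phi> t)) (at t within {0..}) \<and>
      ((\<lambda>t. \<psi> t + g t * \<phi> t) has_real_derivative
        (c t + g' t - (b t - g t)\<^sup>2) * \<phi> t - (b t - g t) * (\<psi> t + g t * \<phi> t)) (at t within {0..})"
  proof
    show "(\<phi> has_real_derivative (b t - g t) * \<phi> t + (\<psi> t + g t * \<phi> t)) (at t within {0..})"
      using D(1) by (simp add: algebra_simps)
    show "((\<lambda>t. \<psi> t + g t * \<phi> t) has_real_derivative
        (c t + g' t - (b t - g t)\<^sup>2) * \<phi> t - (b t - g t) * (\<psi> t + g t * \<phi> t)) (at t within {0..})"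
      by (rule derivative_eq_intros D refl)+ (simp add: algebra_simps power2_eq_square)
  qed
qed

text \<open>The path itself is unaffected by the shift, so limits proved with the small function b -
  g hold for b.\<close>

lemma lin_path_shift: "lin_path jv (\<lambda>t. b t - g t) \<phi> (\<lambda>t. \<psi> t + g t * \<phi> t) = lin_path jv b \<phi> \<psi>"
  by (auto simp: lin_path_def fun_eq_iff field_simps)

lemma growing_potential_moving_average:
  assumes "\<beta> > 0" and b: "continuous_on {0..} b" and osc: "subsqrt_osc b"
    and g: "\<And>t. t \<ge> 0 \<Longrightarrow> (g has_real_derivative b (t + 1) - b t) (at t within {0..})"
      "\<And>t. t \<ge> 0 \<Longrightarrow> \<exists>s\<in>{t..t+1}. g t = b s"
  shows "\<exists>\<kappa> \<epsilon> T. growing_potential (\<lambda>t. a + \<beta> / 4 * t + (b (t + 1) - b t)) (\<lambda>t. b t - g t) \<kappa> \<epsilon> T"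
proof -
  \<comment> \<open>With \<kappa> = 2 \<epsilon>, the square in \<open>drift\<close> is at most (3
    \<epsilon>)^2 t = 9 \<beta> t / 256, and the increment of b costs at most \<beta> t / 16. Of
    \<beta> t / 4 this leaves 39 \<beta> t / 256, more than the \<beta> t / 8 that absorbs the
    constants by the last entry of T.\<close>
  define \<epsilon> where "\<epsilon> = sqrt \<beta> / 16"
  have \<epsilon>: "\<epsilon> > 0" "\<epsilon>\<^sup>2 = \<beta> / 256" using assms(1) by (simp_all add: \<epsilon>_def power_divide)
  obtain T1 where T1: "\<And>t s. t \<ge> T1 \<Longrightarrow> s \<in> {t..t+1} \<Longrightarrow> \<bar>b s - b t\<bar> \<le> \<epsilon> * sqrt t"
    using osc \<epsilon>(1) unfolding subsqrt_osc_def by blast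
  have "\<beta> / 16 > 0" using assms(1) by simp
  then obtain T2 where T2: "\<And>t s. t \<ge> T2 \<Longrightarrow> s \<in> {t..t+1} \<Longrightarrow> \<bar>b s - b t\<bar> \<le> \<beta> / 16 * sqrt t"
    using osc unfolding subsqrt_osc_def by blast
  define T where "T = Max {1, T1, T2, 8 * (1 + 2 * \<epsilon> + \<bar>a\<bar>) / \<beta>}"
  have T: "T \<ge> 1" "T \<ge> T1" "T \<ge> T2" "T \<ge> 8 * (1 + 2 * \<epsilon> + \<bar>a\<bar>) / \<beta>"
    by (auto simp: T_def)
  have cg: "continuous_on {0..} g" by (rule DERIV_continuous_on[OF g(1)]) simp
  have d: "\<bar>b t - g t\<bar> \<le> \<epsilon> * sqrt t" if "t \<ge> T" for t
    using g(2)[of t] T1[of t] T that by (fastforce simp: abs_minus_commute)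
  have "growing_potential (\<lambda>t. a + \<beta> / 4 * t + (b (t + 1) - b t)) (\<lambda>t. b t - g t) (2 * \<epsilon>) \<epsilon> T"
  proof
    show "continuous_on {0..} (\<lambda>t. a + \<beta> / 4 * t + (b (t + 1) - b t))"
      by (intro continuous_intros b continuous_on_compose2[OF b]) auto
    show "continuous_on {0..} (\<lambda>t. b t - g t)" by (intro continuous_intros b cg)
    fix t w assume t: "t \<ge> T" and w: "\<bar>w\<bar> \<le> 2 * \<epsilon> * sqrt t"
    have t1: "t \<ge> 1" using t T by simp
    have "sqrt t * 1 \<le> sqrt t * sqrt t" using t1 by (intro mult_left_mono) auto
    then have "sqrt t \<le> t" using t1 by simp
    then have "\<beta> / 16 * sqrt t \<le> \<beta> / 16 * t" using assms(1) by (intro mult_left_mono) auto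
    with T2[of t "t + 1"] t T have 1: "\<bar>b (t + 1) - b t\<bar> \<le> \<beta> / 16 * t" by auto
    have "\<bar>w + (b t - g t)\<bar> \<le> 3 * \<epsilon> * sqrt t"
      using w d[OF t] by linarith
    then have "\<bar>w + (b t - g t)\<bar>\<^sup>2 \<le> (3 * \<epsilon> * sqrt t)\<^sup>2" by (rule power_mono) simp
    then have 2: "(w + (b t - g t))\<^sup>2 \<le> 9 / 256 * \<beta> * t"
      using t1 by (simp add: power_mult_distrib \<epsilon>(2))
    have "8 * (1 + 2 * \<epsilon> + \<bar>a\<bar>) / \<beta> \<le> t" using T t by simp
    then have 3: "1 + 2 * \<epsilon> + \<bar>a\<bar> \<le> \<beta> * t / 8" using assms(1) by (simp add: field_simps)
    have 4: "\<beta> * t \<ge> 0" using assms(1) t1 by simp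
    show "1 + 2 * \<epsilon> \<le> a + \<beta> / 4 * t + (b (t + 1) - b t) - (w + (b t - g t))\<^sup>2"
      using 1 2 3 4 by linarith
  qed (use T \<epsilon> d in auto)
  then show ?thesis by blast
qed

lemma lin_path_limits:
  fixes a \<beta> :: real
  assumes "\<beta> > 0" and b: "continuous_on {0..} b" and osc: "subsqrt_osc b"
  defines "sol \<equiv> \<lambda>\<phi> \<psi>. lin_sys (\<lambda>t. a + \<beta> / 4 * t) b \<phi> \<psi> \<and> (\<forall>t\<ge>0. \<phi> t \<noteq> 0 \<or> \<psi> t \<noteq> 0)"
  shows lin_path_limit_dichotomy:
      "sol \<phi> \<psi> \<Longrightarrow> (lin_path jv b \<phi> \<psi> \<longlongrightarrow> \<infinity>) at_top \<or> (lin_path jv b \<phi> \<psi> \<longlongrightarrow> -\<infinity>) at_top"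
    and lin_path_MInfty_exists:
      "\<exists>\<phi> \<psi>. sol \<phi> \<psi> \<and> (lin_path jv b \<phi> \<psi> \<longlongrightarrow> -\<infinity>) at_top"
    and lin_path_MInfty_unique:
      "sol \<phi> \<psi> \<Longrightarrow> sol \<phi>' \<psi>' \<Longrightarrow> (lin_path jv b \<phi> \<psi> \<longlongrightarrow> -\<infinity>) at_top \<Longrightarrow>
        (lin_path jv b \<phi>' \<psi>' \<longlongrightarrow> -\<infinity>) at_top \<Longrightarrow> t \<ge> 0 \<Longrightarrow> lin_path jv b \<phi> \<psi> t = lin_path jv b \<phi>' \<psi>' t"
proof -
  obtain g where g: "\<And>t. t \<ge> 0 \<Longrightarrow> (g has_real_derivative b (t + 1) - b t) (at t within {0..})"
    "\<And>t. t \<ge> 0 \<Longrightarrow> \<exists>s\<in>{t..t+1}. g t = b s"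
    using moving_average_exists[OF b] by blast
  obtain \<kappa> \<epsilon> T where "growing_potential (\<lambda>t. a + \<beta> / 4 * t + (b (t + 1) - b t)) (\<lambda>t. b t - g t) \<kappa> \<epsilon> T"
    using growing_potential_moving_average[OF assms(1) b osc g] by blast
  then interpret growing_potential "\<lambda>t. a + \<beta> / 4 * t + (b (t + 1) - b t)" "\<lambda>t. b t - g t" \<kappa> \<epsilon> T .
  have shift: "lin_sys (\<lambda>t. a + \<beta> / 4 * t + (b (t + 1) - b t)) (\<lambda>t. b t - g t) \<phi> (\<lambda>t. \<psi> t + g t * \<phi> t)"
      "t \<ge> 0 \<Longrightarrow> \<phi> t \<noteq> 0 \<or> \<psi> t + g t * \<phi> t \<noteq> 0" if "sol \<phi> \<psi>" for \<phi> \<psi> t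
    using that lin_sys_shift[OF _ g(1)] unfolding sol_def by force+
  \<comment> \<open>An exact criterion: by uniqueness of limits, tending to -\<infinity> also
    implies that the product is nonpositive from T on.\<close>
  have limit: "(lin_path jv b \<phi> \<psi> \<longlongrightarrow> (if \<exists>t\<ge>T. \<phi> t * (\<psi> t + g t * \<phi> t) > 0 then \<infinity> else -\<infinity>)) at_top"
    if "sol \<phi> \<psi>" for \<phi> \<psi> jv
    using tendsto_PInfty_if_prod_pos[OF shift(1)[OF that], of _ jv]
      tendsto_MInfty_if_prod_nonpos[OF shift[OF that], of jv]
    unfolding lin_path_shift by (auto simp: not_less)
  show "sol \<phi> \<psi> \<Longrightarrow> (lin_path jv b \<phi> \<psi> \<longlongrightarrow> \<infinity>) at_top \<or> (lin_path jv b \<phi> \<psi> \<longlongrightarrow> -\<infinity>) at_top"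
    using limit[of \<phi> \<psi> jv] by (auto split: if_splits)
  obtain \<phi>0 \<psi>0 where 0: "lin_sys (\<lambda>t. a + \<beta> / 4 * t + (b (t + 1) - b t)) (\<lambda>t. b t - g t) \<phi>0 \<psi>0"
    "\<And>t. t \<ge> 0 \<Longrightarrow> \<phi>0 t \<noteq> 0 \<or> \<psi>0 t \<noteq> 0" "\<And>t. t \<ge> T \<Longrightarrow> \<phi>0 t * \<psi>0 t \<le> 0"
    using prod_nonpos_exists by blast
  \<comment> \<open>Shifting by -g undoes the shift and brings the solution found in the locale back
    to the system for b.\<close>
  have "((\<lambda>t. - g t) has_real_derivative - (b (t + 1) - b t)) (at t within {0..})" if "t \<ge> 0" for t
    by (intro DERIV_minus g(1) that)
  from lin_sys_shift[OF 0(1) this] have "sol \<phi>0 (\<lambda>t. \<psi>0 t - g t * \<phi>0 t)"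
    using 0(2) by (force simp: sol_def)
  moreover have "(lin_path jv b \<phi>0 (\<lambda>t. \<psi>0 t - g t * \<phi>0 t) \<longlongrightarrow> -\<infinity>) at_top"
    using limit[OF calculation, of jv] 0(3) by (auto simp: not_le[symmetric] split: if_splits)
  ultimately show "\<exists>\<phi> \<psi>. sol \<phi> \<psi> \<and> (lin_path jv b \<phi> \<psi> \<longlongrightarrow> -\<infinity>) at_top" by blast
  assume sol: "sol \<phi> \<psi>" "sol \<phi>' \<psi>'" and lim: "(lin_path jv b \<phi> \<psi> \<longlongrightarrow> -\<infinity>) at_top"
      "(lin_path jv b \<phi>' \<psi>' \<longlongrightarrow> -\<infinity>) at_top" and t: "t \<ge> 0"
  have nonpos: "\<phi> t * (\<psi> t + g t * \<phi> t) \<le> 0"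
    if "sol \<phi> \<psi>" "(lin_path jv b \<phi> \<psi> \<longlongrightarrow> -\<infinity>) at_top" "t \<ge> T" for \<phi> \<psi> t
    using tendsto_unique[OF _ limit[OF that(1)] that(2)] that(3) by (force split: if_splits simp: not_less)
  \<comment> \<open>The shift is a shear, so the terms with g cancel and the Wronskian is that of
    the unshifted solutions.\<close>
  have "\<phi> 0 * (\<psi>' 0 + g 0 * \<phi>' 0) - \<phi>' 0 * (\<psi> 0 + g 0 * \<phi> 0) = 0"
    by (rule wronskian_eq_0_if_prod_nonpos[OF shift(1)[OF sol(1)] shift(1)[OF sol(2)]
        nonpos[OF sol(1) lim(1)] nonpos[OF sol(2) lim(2)]])
  then have "\<phi> 0 * \<psi>' 0 - \<phi>' 0 * \<psi> 0 = 0" by (simp add: algebra_simps)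
  moreover have "continuous_on {0..} (\<lambda>t. a + \<beta> / 4 * t)" by (intro continuous_intros)
  ultimately have "\<phi> t = 0 \<longleftrightarrow> \<phi>' t = 0" "\<psi> t / \<phi> t = \<psi>' t / \<phi>' t"
    using lin_sys_proportional[OF _ b, of _ \<phi> \<psi> \<phi>' \<psi>' t] sol t unfolding sol_def by blast+
  then show "lin_path jv b \<phi> \<psi> t = lin_path jv b \<phi>' \<psi>' t"
    by (simp add: lin_path_def)
qed

section \<open>Transfer to forward and backward Riccati paths\<close>

lemma riccati_path_limits:
  assumes "\<beta> > 0" and b: "continuous_on {0..} b" and osc: "subsqrt_osc b"
  shows forward_diffusion_limits: "0 \<le> t0 \<Longrightarrow> x0 \<noteq> -\<infinity> \<Longrightarrow>
       (\<exists>Z. forward_diffusion \<beta> a b t0 x0 Z) \<and>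
       (\<forall>Z. forward_diffusion \<beta> a b t0 x0 Z \<longrightarrow> (Z \<longlongrightarrow> \<infinity>) at_top \<or> (Z \<longlongrightarrow> -\<infinity>) at_top)"
    and backward_path_unique: "\<exists>Zh. backward_path \<beta> a b Zh \<and> (Zh \<longlongrightarrow> -\<infinity>) at_top \<and>
        (\<forall>Z. backward_path \<beta> a b Z \<and> (Z \<longlongrightarrow> -\<infinity>) at_top \<longrightarrow> (\<forall>t\<ge>0. Z t = Zh t))"
proof -
  have q: "continuous_on {0..} (\<lambda>t. a + \<beta> / 4 * t)" by (intro continuous_intros)
  have eventually_eq: "(Z \<longlongrightarrow> l) at_top \<longleftrightarrow> (Z' \<longlongrightarrow> l) at_top"
    if "\<And>t. t \<ge> t0 \<Longrightarrow> Z t = Z' t" for Z Z' :: "real \<Rightarrow> ereal" and l t0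
    by (rule tendsto_cong) (use that in \<open>auto simp: eventually_at_top_linorder\<close>)
  show "(\<exists>Z. forward_diffusion \<beta> a b t0 x0 Z) \<and>
       (\<forall>Z. forward_diffusion \<beta> a b t0 x0 Z \<longrightarrow> (Z \<longlongrightarrow> \<infinity>) at_top \<or> (Z \<longlongrightarrow> -\<infinity>) at_top)"
    if t0: "0 \<le> t0" and x0: "x0 \<noteq> -\<infinity>"
  proof (intro conjI allI impI)
    obtain \<phi> \<psi> where lin: "lin_sys (\<lambda>t. a + \<beta> / 4 * t) b \<phi> \<psi>"
      and init: "\<phi> t0 = (if x0 = \<infinity> then 0 else 1)" "\<psi> t0 = (if x0 = \<infinity> then 1 else real_of_ereal x0 - b t0)"
      using lin_sys_exists[OF q b t0] by blast
    have nz: "\<phi> t \<noteq> 0 \<or> \<psi> t \<noteq> 0" if "t \<ge> 0" for t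
      by (rule lin_sys_nontrivial[OF q b lin t0 _ that]) (auto simp: init)
    have "lin_path \<infinity> b \<phi> \<psi> t0 = x0"
      using x0 by (cases x0) (auto simp: lin_path_def init)
    then show "\<exists>Z. forward_diffusion \<beta> a b t0 x0 Z"
      using riccati_path_lin_path[OF lin b nz t0] unfolding forward_diffusion_def by blast
    fix Z assume "forward_diffusion \<beta> a b t0 x0 Z"
    then have Z: "riccati_path \<beta> a b {t0..} \<infinity> Z" by (simp add: forward_diffusion_def)
    obtain \<phi> \<psi> where sol: "lin_sys (\<lambda>t. a + \<beta> / 4 * t) b \<phi> \<psi>" "\<And>t. t \<ge> 0 \<Longrightarrow> \<phi> t \<noteq> 0 \<or> \<psi> t \<noteq> 0"
      and eq: "\<And>t. t \<ge> t0 \<Longrightarrow> Z t = lin_path \<infinity> b \<phi> \<psi> t"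
      using riccati_path_eq_lin_path[OF Z t0 b disjI1[OF refl]] by metis
    have "(lin_path \<infinity> b \<phi> \<psi> \<longlongrightarrow> \<infinity>) at_top \<or> (lin_path \<infinity> b \<phi> \<psi> \<longlongrightarrow> -\<infinity>) at_top"
      by (rule lin_path_limit_dichotomy[OF assms, of a]) (use sol in blast)
    moreover have "(Z \<longlongrightarrow> l) at_top \<longleftrightarrow> (lin_path \<infinity> b \<phi> \<psi> \<longlongrightarrow> l) at_top" for l
      by (rule eventually_eq[OF eq])
    ultimately show "(Z \<longlongrightarrow> \<infinity>) at_top \<or> (Z \<longlongrightarrow> -\<infinity>) at_top" by simp
  qed
  obtain \<phi> \<psi> where sol: "lin_sys (\<lambda>t. a + \<beta> / 4 * t) b \<phi> \<psi> \<and> (\<forall>t\<ge>0. \<phi> t \<noteq> 0 \<or> \<psi> t \<noteq> 0)"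
    and lim: "(lin_path (-\<infinity>) b \<phi> \<psi> \<longlongrightarrow> -\<infinity>) at_top"
    using lin_path_MInfty_exists[OF assms] by blast
  show "\<exists>Zh. backward_path \<beta> a b Zh \<and> (Zh \<longlongrightarrow> -\<infinity>) at_top \<and>
        (\<forall>Z. backward_path \<beta> a b Z \<and> (Z \<longlongrightarrow> -\<infinity>) at_top \<longrightarrow> (\<forall>t\<ge>0. Z t = Zh t))"
  proof (intro exI[of _ "lin_path (-\<infinity>) b \<phi> \<psi>"] conjI allI impI)
    show "backward_path \<beta> a b (lin_path (-\<infinity>) b \<phi> \<psi>)"
      unfolding backward_path_def using sol by (intro riccati_path_lin_path b) auto
    fix Z and t :: real assume Z: "backward_path \<beta> a b Z \<and> (Z \<longlongrightarrow> -\<infinity>) at_top" and t: "t \<ge> 0"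
    then have "riccati_path \<beta> a b {0..} (-\<infinity>) Z" by (simp add: backward_path_def)
    from riccati_path_eq_lin_path[OF this order_refl b disjI2[OF refl]]
    obtain \<phi>' \<psi>' where sol': "lin_sys (\<lambda>t. a + \<beta> / 4 * t) b \<phi>' \<psi>' \<and> (\<forall>t\<ge>0. \<phi>' t \<noteq> 0 \<or> \<psi>' t \<noteq> 0)"
      and eq: "\<And>t. t \<ge> 0 \<Longrightarrow> Z t = lin_path (-\<infinity>) b \<phi>' \<psi>' t" by metis
    have "(lin_path (-\<infinity>) b \<phi>' \<psi>' \<longlongrightarrow> -\<infinity>) at_top"
      using Z eventually_eq[of 0 Z "lin_path (-\<infinity>) b \<phi>' \<psi>'" "-\<infinity>"] eq by blast
    then show "Z t = lin_path (-\<infinity>) b \<phi> \<psi> t"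
      using lin_path_MInfty_unique[OF assms sol' sol _ lim t] eq[OF t] by simp
  qed (fact lim)
qed

section \<open>Oscillation of Brownian motion\<close>

text \<open>A dyadic point of level k + 1 is at most one increment of that level away from a point
  of level k, and the bounds A (9/10)^k sum to 10 A. Continuity extends the bound from dyadic points
  to all t.\<close>

lemma dyadic_chaining:
  fixes b :: "real \<Rightarrow> real"
  assumes incr: "\<And>k j. j < 2 ^ k \<Longrightarrow>
      \<bar>b (x + real (Suc j) / 2 ^ k) - b (x + real j / 2 ^ k)\<bar> \<le> A * (9 / 10) ^ k"
    and b: "continuous_on {x..x+1} b" and t: "t \<in> {x..x+1}"
  shows "\<bar>b t - b x\<bar> \<le> 10 * A"
proof -
  have A: "A \<ge> 0" using order_trans[OF abs_ge_zero incr[of 0 0]] by simp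
  \<comment> \<open>The right-hand side is the sum of A (9/10)^i over i \<le> k, kept exact so that
    the induction closes.\<close>
  have dyadic: "\<bar>b (x + real j / 2 ^ k) - b x\<bar> \<le> 10 * A * (1 - (9 / 10) ^ Suc k)" if "j \<le> 2 ^ k" for j k
    using that
  proof (induction k arbitrary: j)
    case 0
    then have "j = 0 \<or> j = 1" by auto
    then show ?case using incr[of 0 0] A by auto
  next
    case (Suc k)
    define i where "i = j div 2"
    have "10 * A * (9 / 10) ^ Suc (Suc k) \<le> 10 * A * (9 / 10) ^ Suc k"
      using A by (intro mult_left_mono power_decreasing) auto
    then have mono: "10 * A * (1 - (9 / 10) ^ Suc k) \<le> 10 * A * (1 - (9 / 10) ^ Suc (Suc k))"
      by (simp add: algebra_simps)
    have i: "i \<le> 2 ^ k" using Suc.prems by (simp add: i_def)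
    show ?case
    proof (cases "even j")
      case True
      then have "j = 2 * i" by (simp add: i_def)
      then have "real j / 2 ^ Suc k = real i / 2 ^ k" by simp
      then show ?thesis using Suc.IH[OF i] mono by simp
    next
      case False
      then have j: "j = Suc (2 * i)" by (simp add: i_def)
      then have "2 * i < 2 ^ Suc k" using Suc.prems by simp
      from incr[OF this] have "\<bar>b (x + real j / 2 ^ Suc k) - b (x + real i / 2 ^ k)\<bar> \<le> A * (9 / 10) ^ Suc k"
        by (simp add: j)
      moreover have "10 * A * (1 - (9 / 10) ^ Suc k) + A * (9 / 10) ^ Suc k = 10 * A * (1 - (9 / 10) ^ Suc (Suc k))"
        by (simp add: algebra_simps)
      ultimately show ?thesis using Suc.IH[OF i] by linarith
    qed
  qed
  define j where "j k = nat \<lfloor>(t - x) * 2 ^ k\<rfloor>" for k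
  have j: "real (j k) \<le> (t - x) * 2 ^ k" "(t - x) * 2 ^ k < real (j k) + 1" for k
    using t by (auto simp: j_def)
  have j_le: "j k \<le> 2 ^ k" for k
  proof -
    have "(t - x) * 2 ^ k \<le> 1 * 2 ^ k" using t by (intro mult_right_mono) auto
    with j(1)[of k] have "real (j k) \<le> 2 ^ k" by linarith
    then show ?thesis by (metis of_nat_le_iff of_nat_numeral of_nat_power)
  qed
  define u where "u k = x + real (j k) / 2 ^ k" for k
  have u: "t - (1 / 2) ^ k \<le> u k" "u k \<le> t" "x \<le> u k" for k
  proof -
    have "real (j k) / 2 ^ k \<le> t - x" "t - x < (real (j k) + 1) / 2 ^ k"
      using j[of k] by (simp_all add: pos_divide_le_eq pos_less_divide_eq)
    then show "t - (1 / 2) ^ k \<le> u k" "u k \<le> t" "x \<le> u k"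
      by (simp_all add: u_def add_divide_distrib power_one_over)
  qed
  have "u \<longlonglongrightarrow> t"
  proof (rule tendsto_sandwich)
    show "(\<lambda>k. t - (1 / 2) ^ k) \<longlonglongrightarrow> t"
      by (auto intro!: tendsto_eq_intros LIMSEQ_realpow_zero)
  qed (use u in auto)
  then have "(\<lambda>k. b (u k)) \<longlonglongrightarrow> b t"
  proof (rule continuous_on_tendsto_compose[OF b _ t])
    have "u k \<in> {x..x+1}" for k using u(2,3)[of k] t by auto
    then show "\<forall>\<^sub>F k in sequentially. u k \<in> {x..x+1}" by simp
  qed
  then have "(\<lambda>k. \<bar>b (u k) - b x\<bar>) \<longlonglongrightarrow> \<bar>b t - b x\<bar>" by (intro tendsto_intros)
  moreover have "\<bar>b (u k) - b x\<bar> \<le> 10 * A" for k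
  proof -
    have "10 * A * (1 - (9 / 10) ^ Suc k) \<le> 10 * A * 1" using A by (intro mult_left_mono) auto
    then show ?thesis using dyadic[OF j_le, of k] by (simp add: u_def)
  qed
  ultimately show ?thesis by (intro LIMSEQ_le_const2) auto
qed

lemma subsqrt_oscI:
  assumes "\<And>\<delta>. \<delta> > 0 \<Longrightarrow> \<forall>\<^sub>F n in sequentially. \<forall>t\<in>{real n..real n + 1}. \<bar>b t - b (real n)\<bar> \<le> \<delta> * sqrt (real n + 1)"
  shows "subsqrt_osc b"
  unfolding subsqrt_osc_def
proof (intro allI impI)
  fix \<epsilon> :: real assume "\<epsilon> > 0"
  \<comment> \<open>A window [t, t + 1] meets two integer windows. Three bounds of the form \<delta>
    sqrt (n + 2) are added, and sqrt (n + 2) \<le> 2 sqrt t, giving the factor 6.\<close>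
  define \<delta> where "\<delta> = \<epsilon> / 6"
  have \<delta>: "\<delta> > 0" using \<open>\<epsilon> > 0\<close> by (simp add: \<delta>_def)
  from assms[OF this] obtain N where N: "\<And>n t. n \<ge> N \<Longrightarrow> t \<in> {real n..real n + 1} \<Longrightarrow>
      \<bar>b t - b (real n)\<bar> \<le> \<delta> * sqrt (real n + 1)"
    unfolding eventually_sequentially by blast
  show "\<exists>T. \<forall>t\<ge>T. \<forall>s\<in>{t..t+1}. \<bar>b s - b t\<bar> \<le> \<epsilon> * sqrt t"
  \<comment> \<open>The extra 1 gives both n \<ge> N after rounding down and t \<ge> 1, hence n + 2
    \<le> 4 t.\<close>
  proof (intro exI[of _ "real N + 1"] allI impI ballI)
    fix t s assume t: "real N + 1 \<le> t" and s: "s \<in> {t..t+1}"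
    define n where "n = nat \<lfloor>t\<rfloor>"
    have n: "real n \<le> t" "t < real n + 1" using t by (auto simp: n_def)
    then have "n \<ge> N" using t by linarith
    have "real n + 2 \<le> 4 * t" using n t by linarith
    then have "sqrt (real n + 2) \<le> sqrt (4 * t)" by simp
    also have "\<dots> = 2 * sqrt t" by (simp add: real_sqrt_mult)
    finally have sq: "\<delta> * sqrt (real n + 2) \<le> \<delta> * (2 * sqrt t)"
      using \<delta> by (intro mult_left_mono) auto
    have "\<delta> * sqrt (real n + 1) \<le> \<delta> * sqrt (real n + 2)"
      using \<delta> by (intro mult_left_mono) auto
    then have bd: "\<bar>b r - b (real n)\<bar> \<le> \<delta> * sqrt (real n + 2)" if "r \<in> {real n..real n + 1}" for r
      using N[OF \<open>n \<ge> N\<close> that] by linarith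
    have bd': "\<bar>b r - b (real n + 1)\<bar> \<le> \<delta> * sqrt (real n + 2)" if "r \<in> {real n + 1..real n + 2}" for r
      using N[of "Suc n" r] \<open>n \<ge> N\<close> that by (simp add: algebra_simps)
    have "\<bar>b s - b (real n)\<bar> \<le> 2 * (\<delta> * sqrt (real n + 2))"
    proof (cases "s \<le> real n + 1")
      case True
      then have "\<bar>b s - b (real n)\<bar> \<le> \<delta> * sqrt (real n + 2)" using s n by (intro bd) auto
      then show ?thesis by linarith
    next
      case False
      then show ?thesis using bd[of "real n + 1"] bd'[of s] s n by auto
    qed
    moreover have "\<bar>b t - b (real n)\<bar> \<le> \<delta> * sqrt (real n + 2)" using n by (intro bd) auto
    ultimately have "\<bar>b s - b t\<bar> \<le> 3 * (\<delta> * sqrt (real n + 2))" by linarith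
    also have "\<dots> \<le> \<epsilon> * sqrt t" using sq by (simp add: \<delta>_def)
    finally show "\<bar>b s - b t\<bar> \<le> \<epsilon> * sqrt t" .
  qed
qed

lemma nn_integral_normal_pow4:
  assumes "h > 0" and X: "distributed M lborel X (\<lambda>x. ennreal (normal_density 0 (sqrt h) x))"
  shows "(\<integral>\<^sup>+\<omega>. ennreal (X \<omega> ^ 4) \<partial>M) = ennreal (3 * h\<^sup>2)"
proof -
  have m: "has_bochner_integral lborel (\<lambda>x. normal_density 0 (sqrt h) x * x ^ 4) (3 * h\<^sup>2)"
    using normal_moment_even[of "sqrt h" 0 2] assms(1)
    by (simp add: power2_eq_square field_simps fact_numeral)
  have "(\<integral>\<^sup>+\<omega>. ennreal (X \<omega> ^ 4) \<partial>M) = (\<integral>\<^sup>+x. ennreal (normal_density 0 (sqrt h) x) * ennreal (x ^ 4) \<partial>lborel)"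
    by (rule distributed_nn_integral[OF X, symmetric]) simp
  also have "\<dots> = (\<integral>\<^sup>+x. ennreal (normal_density 0 (sqrt h) x * x ^ 4) \<partial>lborel)"
    by (simp add: ennreal_mult')
  also have "\<dots> = ennreal (3 * h\<^sup>2)"
    using m by (subst nn_integral_eq_integral) (auto simp: has_bochner_integral_iff)
  finally show ?thesis .
qed

text \<open>All normalised fourth powers of dyadic increments are added into one variable F of
  finite expectation. Where F is finite, the contribution of window n tends to 0, which bounds all
  increments of late windows simultaneously. Fourth powers are used because second moments would
  give the divergent series of 1 / (n + 1).\<close>

lemma brownian_subsqrt_osc:
  assumes BM: "std_brownian_motion M B"
  shows "AE \<omega> in M. subsqrt_osc (\<lambda>t. B t \<omega>)"
proof -
  have meas [measurable]: "B t \<in> borel_measurable M" if "t \<ge> 0" for t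
    using BM that by (simp add: std_brownian_motion_def)
  have dist: "distributed M lborel (\<lambda>\<omega>. B t \<omega> - B s \<omega>) (\<lambda>x. ennreal (normal_density 0 (sqrt (t - s)) x))"
    if "0 \<le> s" "s < t" for s t
    using BM that by (simp add: std_brownian_motion_def)
  have cont: "continuous_on {0..} (\<lambda>t. B t \<omega>)" if "\<omega> \<in> space M" for \<omega>
    using BM that by (simp add: std_brownian_motion_def)
  define \<Delta> where "\<Delta> n k j \<omega> = B (real n + real (Suc j) / 2 ^ k) \<omega> - B (real n + real j / 2 ^ k) \<omega>" for n k j \<omega>
  have \<Delta>_meas [measurable]: "\<Delta> n k j \<in> borel_measurable M" for n k j
    unfolding \<Delta>_def[abs_def] by measurable
  \<comment> \<open>The weight for which c \<Delta>^4 \<le> \<delta>^4 says exactly that |\<Delta>|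
    \<le> \<delta> sqrt (n + 1) (9/10)^k, the hypothesis of the chaining bound.\<close>
  define c :: "nat \<Rightarrow> nat \<Rightarrow> real" where "c n k = (10 / 9) ^ (4 * k) / (real n + 1)\<^sup>2" for n k
  have c: "c n k > 0" for n k by (simp add: c_def)
  define S where "S n k \<omega> = (\<Sum>j<2 ^ k. ennreal (c n k * \<Delta> n k j \<omega> ^ 4))" for n k \<omega>
  \<comment> \<open>The fourth moments sum because \<open>r < 1\<close>; this dictates a chaining rate above \<open>2 powr (-1/4)\<close>, here \<open>9/10\<close>.\<close>
  define r :: real where "r = (10 / 9) ^ 4 * (1 / 2)"
  have E: "(\<integral>\<^sup>+\<omega>. S n k \<omega> \<partial>M) = ennreal (3 / (real n + 1)\<^sup>2 * r ^ k)" for n k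
  proof -
    have 1: "(\<integral>\<^sup>+\<omega>. ennreal (c n k * \<Delta> n k j \<omega> ^ 4) \<partial>M) = ennreal (c n k * (3 * (1 / 2 ^ k)\<^sup>2))" for j
    proof -
      have "distributed M lborel (\<Delta> n k j) (\<lambda>x. ennreal (normal_density 0
          (sqrt ((real n + real (Suc j) / 2 ^ k) - (real n + real j / 2 ^ k))) x))"
        unfolding \<Delta>_def[abs_def] by (rule dist) (simp_all add: divide_strict_right_mono)
      also have "(real n + real (Suc j) / 2 ^ k) - (real n + real j / 2 ^ k) = 1 / 2 ^ k"
        by (simp add: field_simps)
      finally have "(\<integral>\<^sup>+\<omega>. ennreal (\<Delta> n k j \<omega> ^ 4) \<partial>M) = ennreal (3 * (1 / 2 ^ k)\<^sup>2)"
        by (intro nn_integral_normal_pow4) auto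
      then show ?thesis
        using c[of n k] by (simp add: ennreal_mult' nn_integral_cmult)
    qed
    have "(\<integral>\<^sup>+\<omega>. S n k \<omega> \<partial>M) = (\<Sum>j<(2::nat) ^ k. ennreal (c n k * (3 * (1 / 2 ^ k)\<^sup>2)))"
      unfolding S_def by (subst nn_integral_sum) (auto simp: 1)
    also have "\<dots> = ennreal (\<Sum>j<(2::nat) ^ k. c n k * (3 * (1 / 2 ^ k)\<^sup>2))"
      using c[of n k] by (intro sum_ennreal) auto
    also have "(\<Sum>j<(2::nat) ^ k. c n k * (3 * (1 / 2 ^ k)\<^sup>2)) = 3 / (real n + 1)\<^sup>2 * r ^ k"
    proof -
      have "2 ^ k * (1 / 2 ^ k)\<^sup>2 = (1 / 2 :: real) ^ k"
        by (simp add: power2_eq_square power_one_over)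
      moreover have "r ^ k = (10 / 9) ^ (4 * k) * (1 / 2) ^ k"
        unfolding r_def power_mult power_mult_distrib ..
      moreover have "2 ^ k * (x / y * (3 * z)) = 3 / y * (x * (2 ^ k * z))" for x y z :: real
        by simp
      ultimately show ?thesis by (simp add: c_def)
    qed
    finally show ?thesis .
  qed
  have r: "0 \<le> r" "r < 1" by (simp_all add: r_def power_divide)
  define F where "F \<omega> = (\<Sum>n k. S n k \<omega>)" for \<omega>
  have S_meas [measurable]: "S n k \<in> borel_measurable M" for n k
    unfolding S_def[abs_def] by measurable
  have "(\<integral>\<^sup>+\<omega>. F \<omega> \<partial>M) = (\<Sum>n k. ennreal (3 / (real n + 1)\<^sup>2 * r ^ k))"
    unfolding F_def by (simp add: nn_integral_suminf E)
  also have "\<dots> = (\<Sum>n. ennreal (3 / (real n + 1)\<^sup>2 * (1 / (1 - r))))"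
    using r by (intro suminf_cong suminf_ennreal_eq sums_mult geometric_sums) auto
  also have "\<dots> \<noteq> \<infinity>"
  proof -
    have "summable (\<lambda>n. 3 / (1 - r) * (1 / real (n + 1) ^ 2))"
      using summable_ignore_initial_segment[OF inverse_power_summable[of 2, where ?'a = real], of 1]
      by (intro summable_mult) (simp add: field_simps)
    then have "summable (\<lambda>n. 3 / (real n + 1)\<^sup>2 * (1 / (1 - r)))"
      by (simp add: field_simps)
    then show ?thesis using r by (simp add: suminf_ennreal2)
  qed
  finally have "AE \<omega> in M. F \<omega> \<noteq> \<infinity>"
    by (intro nn_integral_noteq_infinite) (auto simp: F_def[abs_def])
  then show ?thesis
  proof (rule AE_mp, intro AE_I2 impI)
    fix \<omega> assume \<omega>: "\<omega> \<in> space M" and fin: "F \<omega> \<noteq> \<infinity>"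
    define U where "U n = (\<Sum>k. S n k \<omega>)" for n
    have "U n \<le> F \<omega>" for n
      unfolding F_def U_def[symmetric] using sum_le_suminf[of U "{n}"] by simp
    then have "U n \<noteq> top" for n using fin by (metis infinity_ennreal_def top_unique)
    then have U: "U n = ennreal (enn2real (U n))" for n by (simp add: less_top)
    have "summable (\<lambda>n. enn2real (U n))"
      using fin unfolding F_def U_def[symmetric]
      by (intro summable_suminf_not_top) (simp_all flip: U)
    \<comment> \<open>Convergence to 0 treats every \<delta> on the same event, whereas a
      Borel-Cantelli argument would be run for one \<delta> at a time.\<close>
    then have lim: "(\<lambda>n. enn2real (U n)) \<longlonglongrightarrow> 0" by (rule summable_LIMSEQ_zero)
    have incr: "\<bar>\<Delta> n k j \<omega>\<bar> \<le> \<delta> * sqrt (real n + 1) * (9 / 10) ^ k"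
      if "\<delta> > 0" "enn2real (U n) < \<delta> ^ 4" "j < 2 ^ k" for \<delta> n k j
    proof -
      have "ennreal (c n k * \<Delta> n k j \<omega> ^ 4) \<le> S n k \<omega>"
        unfolding S_def by (rule member_le_sum) (use that in auto)
      also have "\<dots> \<le> U n"
        unfolding U_def using sum_le_suminf[of "\<lambda>k. S n k \<omega>" "{k}"] by simp
      also have "\<dots> = ennreal (enn2real (U n))" by (rule U)
      also have "\<dots> \<le> ennreal (\<delta> ^ 4)" using that(2) by (intro ennreal_leI) simp
      finally have "c n k * \<Delta> n k j \<omega> ^ 4 \<le> \<delta> ^ 4" using that(1) by (simp add: ennreal_le_iff)
      then have "\<Delta> n k j \<omega> ^ 4 \<le> \<delta> ^ 4 / c n k" using c[of n k] by (simp add: field_simps)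
      also have "\<delta> ^ 4 / c n k = (\<delta> * sqrt (real n + 1) * (9 / 10) ^ k) ^ 4"
      proof -
        have "sqrt (real n + 1) ^ 4 = (real n + 1)\<^sup>2"
          using power_mult[of "sqrt (real n + 1)" 2 2] by simp
        moreover have "((9 / 10) ^ k) ^ 4 = inverse ((10 / 9 :: real) ^ (4 * k))"
          by (simp add: power_mult[symmetric] mult.commute power_inverse[symmetric])
        ultimately show ?thesis by (simp add: c_def power_mult_distrib field_simps)
      qed
      finally have "\<bar>\<Delta> n k j \<omega>\<bar> ^ 4 \<le> (\<delta> * sqrt (real n + 1) * (9 / 10) ^ k) ^ 4" by (simp add: power_even_abs)
      then show ?thesis by (rule power_le_imp_le_base[of _ 3, simplified]) (use that in auto)
    qed
    show "subsqrt_osc (\<lambda>t. B t \<omega>)"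
    proof (rule subsqrt_oscI)
      fix \<delta> :: real assume \<delta>: "\<delta> > 0"
      \<comment> \<open>The division by 10 offsets the factor 10 lost in chaining.\<close>
      then have "\<forall>\<^sub>F n in sequentially. enn2real (U n) < (\<delta> / 10) ^ 4"
        by (intro order_tendstoD(2)[OF lim]) simp
      then show "\<forall>\<^sub>F n in sequentially. \<forall>t\<in>{real n..real n + 1}. \<bar>B t \<omega> - B (real n) \<omega>\<bar> \<le> \<delta> * sqrt (real n + 1)"
      proof (rule eventually_mono, intro ballI)
        fix n t assume n: "enn2real (U n) < (\<delta> / 10) ^ 4" and t: "t \<in> {real n..real n + 1}"
        have "\<bar>B t \<omega> - B (real n) \<omega>\<bar> \<le> 10 * (\<delta> / 10 * sqrt (real n + 1))"
        proof (rule dyadic_chaining[OF _ _ t])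
          show "continuous_on {real n..real n + 1} (\<lambda>t. B t \<omega>)"
            by (rule continuous_on_subset[OF cont[OF \<omega>]]) auto
          fix k j :: nat assume "j < 2 ^ k"
          with incr[of "\<delta> / 10" n j k] \<delta> n
          show "\<bar>B (real n + real (Suc j) / 2 ^ k) \<omega> - B (real n + real j / 2 ^ k) \<omega>\<bar>
              \<le> \<delta> / 10 * sqrt (real n + 1) * (9 / 10) ^ k"
            by (simp add: \<Delta>_def)
        qed
        then show "\<bar>B t \<omega> - B (real n) \<omega>\<bar> \<le> \<delta> * sqrt (real n + 1)" by simp
      qed
    qed
  qed
qed

theorem theorem3p2:
  fixes M :: "'w measure" and B :: "real \<Rightarrow> 'w \<Rightarrow> real" and \<beta> :: real
  assumes "\<beta> > 0" and "std_brownian_motion M B"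
  shows "AE \<omega> in M.
    (\<forall>a t0 x0. 0 \<le> t0 \<longrightarrow> x0 \<noteq> -\<infinity> \<longrightarrow>
       (\<exists>Z. forward_diffusion \<beta> a (\<lambda>t. B t \<omega>) t0 x0 Z) \<and>
       (\<forall>Z. forward_diffusion \<beta> a (\<lambda>t. B t \<omega>) t0 x0 Z \<longrightarrow>
          (Z \<longlongrightarrow> \<infinity>) at_top \<or> (Z \<longlongrightarrow> -\<infinity>) at_top)) \<and>
    (\<forall>a. \<exists>Zh. backward_path \<beta> a (\<lambda>t. B t \<omega>) Zh \<and> (Zh \<longlongrightarrow> -\<infinity>) at_top \<and>
        (\<forall>Z. backward_path \<beta> a (\<lambda>t. B t \<omega>) Z \<and> (Z \<longlongrightarrow> -\<infinity>) at_top \<longrightarrow>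
             (\<forall>t\<ge>0. Z t = Zh t)))"
  using brownian_subsqrt_osc[OF assms(2)]
proof (rule AE_mp, intro AE_I2 impI conjI allI)
  \<comment> \<open>With \<omega> fixed, a, t0 and x0 range freely: the exceptional set was chosen
    before them.\<close>
  fix \<omega> assume "\<omega> \<in> space M" and osc: "subsqrt_osc (\<lambda>t. B t \<omega>)"
  then have b: "continuous_on {0..} (\<lambda>t. B t \<omega>)"
    using assms(2) by (simp add: std_brownian_motion_def)
  fix a :: real
  show "\<exists>Zh. backward_path \<beta> a (\<lambda>t. B t \<omega>) Zh \<and> (Zh \<longlongrightarrow> -\<infinity>) at_top \<and>
        (\<forall>Z. backward_path \<beta> a (\<lambda>t. B t \<omega>) Z \<and> (Z \<longlongrightarrow> -\<infinity>) at_top \<longrightarrow> (\<forall>t\<ge>0. Z t = Zh t))"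
    by (rule backward_path_unique[OF assms(1) b osc])
  fix t0 :: real and x0 :: ereal assume "0 \<le> t0" "x0 \<noteq> -\<infinity>"
  note fwd = forward_diffusion_limits[OF assms(1) b osc this, of a]
  show "\<exists>Z. forward_diffusion \<beta> a (\<lambda>t. B t \<omega>) t0 x0 Z" using fwd by blast
  fix Z assume "forward_diffusion \<beta> a (\<lambda>t. B t \<omega>) t0 x0 Z"
  with fwd show "(Z \<longlongrightarrow> \<infinity>) at_top \<or> (Z \<longlongrightarrow> -\<infinity>) at_top" by blast
qed

end
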